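(* Let $\mathfrak g$ be of type $A_{2n}^{(2)}$ ($n\ge 1$) or $D_{n+1}^{(2)}$ ($n\ge 2$) and let $\Lambda$ be a dominant integral weight of level $1$. For every $m\ge 0$, the map $Y\mapsto \pi(Y)=(\lambda^{(0)},\lambda^{(1)},\dots,\lambda^{(n)})$, $$\pi:\mathcal Z(\Lambda)_{\Lambda-m\delta}\longrightarrow \bigsqcup_{m_0+\epsilon m_1=m}\mathcal P(m_0)\times\mathcal P^{(n)}(m_1),$$ is a bijection.
   Context: **Types and weights.** $\mathfrak g$ is of affine type $A_{2n}^{(2)}$ ($n\ge1$) or $D_{n+1}^{(2)}$ ($n\ge2$), with index set $I=\{0,\dots,n\}$, simple roots $\alpha_i$, fundamental weights $\Lambda_i$, and null root $\delta=2\alpha_0+\cdots+2\alpha_{n-1}+\alpha_n$ for $A_{2n}^{(2)}$, $\delta=\alpha_0+\cdots+\alpha_n$ for $D_{n+1}^{(2)}$. The level 1 weights are $\Lambda=\Lambda_0$ for $A_{2n}^{(2)}$ and $\Lambda\in\{\Lambda_0,\Lambda_n\}$ for $D_{n+1}^{(2)}$. Put $\ell=L=2n+1$, $\epsilon=1$ for $A_{2n}^{(2)}$; $\ell=n+1$, $L=2n+2$, $\epsilon=2$ for $D_{n+1}^{(2)}$. **Proper Young walls.** There are infinitely many columns, numbered $1,2,\dots$ from right to left. The blocks of color $0$ (and of color $n$ for $D_{n+1}^{(2)}$) have unit width and thickness and height $\tfrac12$; all other blocks are unit cubes. The ground state wall $Y_\Lambda$ has exactly one half-height block in each column, of color $0$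 if $\Lambda=\Lambda_0$ and $n$ if $\Lambda=\Lambda_n$. On each column of $Y_\Lambda$ blocks are stacked in the following order, repeated periodically with period $L$: $0,1,\dots,n-1,n,n-1,\dots,1,0$ for $A_{2n}^{(2)}$; $0,1,\dots,n-1,n,n,n-1,\dots,1,0$ for $D_{n+1}^{(2)}$, $\Lambda=\Lambda_0$; $n,n-1,\dots,1,0,0,1,\dots,n-1,n$ for $D_{n+1}^{(2)}$, $\Lambda=\Lambda_n$. A Young wall $Y=(y_k)_{k\ge1}$ is obtained by adding finitely many blocks so that the column heights weakly decrease in $k$; $|y_k|$ is the number of blocks added in column $k$. A column is full if its height (ground block included) is an integer, equivalently $\ell\nmid|y_k|$. $Y$ is proper if no two full columns have the same height. Thus a proper Young wall is the same thing as a partition $|Y|=(|y_k|)_{k\ge1}$ whose parts not divisible by $\ell$ are pairwise distinct. $\mathcal Z(\Lambda)$ is the set of proper Young walls. For $Y\in\mathcal Z(\Lambda)$, $\mathrm{wt}(Y)=\Lambda-\sum_{i}k_i\alpha_i$, with $k_i$ the number of added $i$-blocks, and $\mathcal Z(\Lambda)_\lambda=\{Y\in\mathcal Z(\Lambda):\mathrm{wt}(Y)=\lambda\}$. **Beads.** Place one bead at position $|y_k|$ for each nonzero $|y_k|$. For $1\le k<L$, $k\ne\ell$, the runner $R_k$ is the set of positive integers $\equiv k\pmod L$; $R_\ell$ is the set of positive multiples of $\ell$. **Partitions.** $\mathcal P(m)$ is the set of partitions of $m$; $\mathcal P^{(n)}(m)$ is the set of $n$-tuples of partitions with total size $m$.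 Frobenius notation: for $\lambda'=(\lambda'_1>\cdots>\lambda'_r\ge0)$ and $\lambda''=(\lambda''_1>\cdots>\lambda''_r\ge0)$, $(\lambda'|\lambda'')$ is the unique partition $\lambda$ with exactly $r$ diagonal boxes, $\lambda_k=\lambda''_k+k$ and $\lambda^{t}_k=\lambda'_k+k$ for $1\le k\le r$ ($\lambda^t$ the conjugate partition). **The map $\pi$.** Let $Y\in\mathcal Z(\Lambda)_{\Lambda-m\delta}$. $\lambda^{(0)}=(1^{m_1},2^{m_2},\dots)$ where $m_k$ is the number of beads at $k\ell$. For $1\le k\le n$ the runners $R_k$ and $R_{L-k}$ contain the same number of beads. For $j\in\{k,L-k\}$, if $N_1>\cdots>N_r$ are the positions of the beads in $R_j$, put $\mu^{(j)}=\left(\frac{N_i-j}{L}\right)_{1\le i\le r}$. Then $\lambda^{(k)}=(\mu^{(k)}|\mu^{(L-k)})$. The component in $\mathcal P(m_0)$ is $\lambda^{(0)}$ and the component in $\mathcal P^{(n)}(m_1)$ is $(\lambda^{(1)},\dots,\lambda^{(n)})$. *)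

theory Defs
  imports Complex_Main "HOL-Library.Multiset"
begin

section \<open>Affine data\<close>

text \<open>\<open>A_even n\<close> is the type $A_{2n}^{(2)}$ and \<open>D_twisted n\<close> is the type $D_{n+1}^{(2)}$.
  The index set is $\{0,\dots,n\}$ in both cases.\<close>

datatype affine_type = A_even nat | D_twisted nat

fun rank :: "affine_type \<Rightarrow> nat" where
  "rank (A_even n) = n"
| "rank (D_twisted n) = n"

fun admissible :: "affine_type \<Rightarrow> bool" where
  "admissible (A_even n) \<longleftrightarrow> 1 \<le> n"
| "admissible (D_twisted n) \<longleftrightarrow> 2 \<le> n"

fun ell :: "affine_type \<Rightarrow> nat" where
  "ell (A_even n) = 2 * n + 1"
| "ell (D_twisted n) = n + 1"

text \<open>\<open>period\<close> is the number $L$.\<close>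

fun period :: "affine_type \<Rightarrow> nat" where
  "period (A_even n) = 2 * n + 1"
| "period (D_twisted n) = 2 * n + 2"

fun eps :: "affine_type \<Rightarrow> nat" where
  "eps (A_even n) = 1"
| "eps (D_twisted n) = 2"

text \<open>The entry \<open>cartan X i j\<close> is $\langle h_i, \alpha_j\rangle$.  The orientation is the one for
  which the coefficients of the null root are those in \<open>mark\<close>; in $A_{2n}^{(2)}$ the root
  $\alpha_0$ is the shortest one.  Entries outside the index set are $0$.\<close>

fun cartan :: "affine_type \<Rightarrow> nat \<Rightarrow> nat \<Rightarrow> int" where
  "cartan (A_even n) i j =
    (if i > n \<or> j > n then 0
     else if i = j then 2
     else if n = 1 \<and> i = 0 \<and> j = 1 then -4
     else if (i = 0 \<and> j = 1) \<or> (Suc i = n \<and> j = n) then -2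
     else if i = Suc j \<or> j = Suc i then -1
     else 0)"
| "cartan (D_twisted n) i j =
    (if i > n \<or> j > n then 0
     else if i = j then 2
     else if (i = 0 \<and> j = 1) \<or> (i = n \<and> Suc j = n) then -2
     else if i = Suc j \<or> j = Suc i then -1
     else 0)"

fun mark :: "affine_type \<Rightarrow> nat \<Rightarrow> nat" where
  "mark (A_even n) i = (if i = n then 1 else 2)"
| "mark (D_twisted n) i = 1"

text \<open>The coefficients of the canonical central element in the simple coroots.\<close>

fun comark :: "affine_type \<Rightarrow> nat \<Rightarrow> nat" where
  "comark (A_even n) i = (if i = 0 then 1 else 2)"
| "comark (D_twisted n) i = (if i = 0 \<or> i = n then 1 else 2)"

text \<open>A weight is recorded by its values on the basis $h_0,\dots,h_n,d$ of the Cartan subalgebra,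
  where $\alpha_i(d) = \delta_{i0}$ and $\Lambda_i(d) = 0$.  The weights in use
  vanish on \<open>Coroot i\<close> for \<open>i\<close> outside the index set.\<close>

datatype cartan_basis = Coroot nat | Derivation

type_synonym weight = "cartan_basis \<Rightarrow> int"

fun fundamental_weight :: "nat \<Rightarrow> weight" where
  "fundamental_weight i (Coroot j) = (if i = j then 1 else 0)"
| "fundamental_weight i Derivation = 0"

fun simple_root :: "affine_type \<Rightarrow> nat \<Rightarrow> weight" where
  "simple_root X i (Coroot j) = cartan X j i"
| "simple_root X i Derivation = (if i = 0 then 1 else 0)"

definition null_root :: "affine_type \<Rightarrow> weight" where
  "null_root X = (\<lambda>h. \<Sum>i\<le>rank X. int (mark X i) * simple_root X i h)"

text \<open>Dominant integral weights are normalised to be combinations of the fundamental weights,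
  without a multiple of the null root.\<close>

definition dominant_integral :: "affine_type \<Rightarrow> weight \<Rightarrow> bool" where
  "dominant_integral X \<Lambda> \<longleftrightarrow>
    (\<exists>c :: nat \<Rightarrow> nat. \<Lambda> = (\<lambda>h. \<Sum>i\<le>rank X. int (c i) * fundamental_weight i h))"

definition level :: "affine_type \<Rightarrow> weight \<Rightarrow> int" where
  "level X \<Lambda> = (\<Sum>i\<le>rank X. int (comark X i) * \<Lambda> (Coroot i))"


section \<open>Proper Young walls\<close>

text \<open>As the order of stacking is prescribed, a wall is given by the numbers of blocks added to
  its columns: \<open>Y k\<close> is $|y_{k+1}|$.\<close>

type_synonym wall = "nat \<Rightarrow> nat"

definition ground_color :: "affine_type \<Rightarrow> weight \<Rightarrow> nat" where
  "ground_color X \<Lambda> = (if \<Lambda> = fundamental_weight 0 then 0 else rank X)"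

fun stacking :: "affine_type \<Rightarrow> weight \<Rightarrow> nat list" where
  "stacking (A_even n) \<Lambda> = [0..<n] @ [n] @ rev [0..<n]"
| "stacking (D_twisted n) \<Lambda> =
    (if \<Lambda> = fundamental_weight 0 then [0..<n + 1] @ rev [0..<n + 1]
     else rev [0..<n + 1] @ [0..<n + 1])"

text \<open>The color of the block that is added on top of \<open>j\<close> previously added blocks.\<close>

definition block_color :: "affine_type \<Rightarrow> weight \<Rightarrow> nat \<Rightarrow> nat" where
  "block_color X \<Lambda> j = stacking X \<Lambda> ! (j mod period X)"

fun block_height :: "affine_type \<Rightarrow> nat \<Rightarrow> real" where
  "block_height (A_even n) i = (if i = 0 then 1/2 else 1)"
| "block_height (D_twisted n) i = (if i = 0 \<or> i = n then 1/2 else 1)"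

text \<open>The height of a column with \<open>c\<close> added blocks; the first summand is the ground block.\<close>

definition column_height :: "affine_type \<Rightarrow> weight \<Rightarrow> nat \<Rightarrow> real" where
  "column_height X \<Lambda> c =
    block_height X (ground_color X \<Lambda>) + (\<Sum>j<c. block_height X (block_color X \<Lambda> j))"

definition young_wall :: "affine_type \<Rightarrow> weight \<Rightarrow> wall \<Rightarrow> bool" where
  "young_wall X \<Lambda> Y \<longleftrightarrow>
    finite {k. Y k \<noteq> 0} \<and>
    (\<forall>j k. j \<le> k \<longrightarrow> column_height X \<Lambda> (Y k) \<le> column_height X \<Lambda> (Y j))"

definition full_column :: "affine_type \<Rightarrow> weight \<Rightarrow> nat \<Rightarrow> bool" where
  "full_column X \<Lambda> c \<longleftrightarrow> column_height X \<Lambda> c \<in> \<int>"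

definition proper_young_wall :: "affine_type \<Rightarrow> weight \<Rightarrow> wall \<Rightarrow> bool" where
  "proper_young_wall X \<Lambda> Y \<longleftrightarrow>
    young_wall X \<Lambda> Y \<and>
    (\<forall>j k. j \<noteq> k \<and> full_column X \<Lambda> (Y j) \<and> full_column X \<Lambda> (Y k) \<longrightarrow>
      column_height X \<Lambda> (Y j) \<noteq> column_height X \<Lambda> (Y k))"

definition added_blocks :: "affine_type \<Rightarrow> weight \<Rightarrow> wall \<Rightarrow> nat \<Rightarrow> nat" where
  "added_blocks X \<Lambda> Y i = card {(k, j). j < Y k \<and> block_color X \<Lambda> j = i}"

definition wt :: "affine_type \<Rightarrow> weight \<Rightarrow> wall \<Rightarrow> weight" where
  "wt X \<Lambda> Y = (\<lambda>h. \<Lambda> h - (\<Sum>i\<le>rank X. int (added_blocks X \<Lambda> Y i) * simple_root X i h))"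

definition proper_walls :: "affine_type \<Rightarrow> weight \<Rightarrow> weight \<Rightarrow> wall set" where
  "proper_walls X \<Lambda> \<mu> = {Y. proper_young_wall X \<Lambda> Y \<and> wt X \<Lambda> Y = \<mu>}"


section \<open>Partitions\<close>

text \<open>A partition is the weakly decreasing list of its positive parts.\<close>

definition is_partition :: "nat list \<Rightarrow> bool" where
  "is_partition p \<longleftrightarrow> sorted_wrt (\<ge>) p \<and> 0 \<notin> set p"

definition partitions :: "nat \<Rightarrow> nat list set" where
  "partitions m = {p. is_partition p \<and> sum_list p = m}"

definition multipartitions :: "nat \<Rightarrow> nat \<Rightarrow> nat list list set" where
  "multipartitions n m =
    {ps. length ps = n \<and> (\<forall>p \<in> set ps. is_partition p) \<and> (\<Sum>p\<leftarrow>ps. sum_list p) = m}"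

text \<open>Since the total sizes can be read off, the sets \<open>partitions m0 \<times> multipartitions n m1\<close> for
  different \<open>(m0, m1)\<close> are disjoint, and a disjoint union of them is just a union.\<close>

text \<open>Parts are numbered from $1$; parts beyond the length are $0$.\<close>

definition part :: "nat list \<Rightarrow> nat \<Rightarrow> nat" where
  "part p k = (if 1 \<le> k \<and> k \<le> length p then p ! (k - 1) else 0)"

definition conjugate_part :: "nat list \<Rightarrow> nat \<Rightarrow> nat" where
  "conjugate_part p k = card {i. 1 \<le> i \<and> k \<le> part p i}"

definition diagonal_length :: "nat list \<Rightarrow> nat" where
  "diagonal_length p = card {k. 1 \<le> k \<and> k \<le> part p k}"

text \<open>The Frobenius notation $(a|b)$, meant for strictly decreasing lists of equal length.\<close>

definition frobenius :: "nat list \<Rightarrow> nat list \<Rightarrow> nat list" where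
  "frobenius a b = (THE p. is_partition p \<and>
     length a = diagonal_length p \<and> length b = diagonal_length p \<and>
     (\<forall>k. 1 \<le> k \<and> k \<le> diagonal_length p \<longrightarrow>
        part p k = b ! (k - 1) + k \<and> conjugate_part p k = a ! (k - 1) + k))"


section \<open>Beads and the map $\pi$\<close>

definition beads :: "wall \<Rightarrow> nat multiset" where
  "beads Y = image_mset Y (mset_set {k. Y k \<noteq> 0})"

definition runner :: "affine_type \<Rightarrow> nat \<Rightarrow> nat set" where
  "runner X k =
    (if k = ell X then {N. 0 < N \<and> ell X dvd N}
     else {N. 0 < N \<and> N mod period X = k mod period X})"

text \<open>The positions of the beads in a runner, in decreasing order.\<close>

definition runner_beads :: "affine_type \<Rightarrow> wall \<Rightarrow> nat \<Rightarrow> nat list" where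
  "runner_beads X Y k = rev (sorted_list_of_multiset {# N \<in># beads Y. N \<in> runner X k #})"

text \<open>The division is exact, as the positions on runner \<open>j < period X\<close> are at least \<open>j\<close> and
  congruent to \<open>j\<close>.\<close>

definition mu :: "affine_type \<Rightarrow> wall \<Rightarrow> nat \<Rightarrow> nat list" where
  "mu X Y j = map (\<lambda>N. (N - j) div period X) (runner_beads X Y j)"

text \<open>The component $\lambda^{(0)}$ has one part $k$ for each bead at position $k\ell$.\<close>

definition pi_map :: "affine_type \<Rightarrow> wall \<Rightarrow> nat list \<times> nat list list" where
  "pi_map X Y =
    (map (\<lambda>N. N div ell X) (runner_beads X Y (ell X)),
     map (\<lambda>k. frobenius (mu X Y k) (mu X Y (period X - k))) [1..<rank X + 1])"


section \<open>Consistency of the conventions\<close>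

lemma null_root_coroot:
  assumes "admissible X" "j \<le> rank X"
  shows "null_root X (Coroot j) = 0"
proof -
  let ?n = "rank X"
  let ?f = "\<lambda>i. int (mark X i) * cartan X j i"
  have n: "?n \<ge> 1" using assms(1) by (cases X) auto
  have supp: "(\<Sum>i\<le>?n. ?f i) = (\<Sum>i\<in>{i. i \<le> ?n \<and> (i = j \<or> Suc i = j \<or> i = Suc j)}. ?f i)"
    by (rule sum.mono_neutral_right) (cases X; auto)+
  consider "j = 0" | "j = ?n" "j > 0" | "0 < j" "j < ?n" using assms(2) by linarith
  then have "(\<Sum>i\<le>?n. ?f i) = 0"
  proof cases
    case 1
    then have "{i. i \<le> ?n \<and> (i = j \<or> Suc i = j \<or> i = Suc j)} = {0, 1}" using n by auto
    with supp 1 n assms(1) show ?thesis by (cases X) auto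
  next
    case 2
    then have "{i. i \<le> ?n \<and> (i = j \<or> Suc i = j \<or> i = Suc j)} = {j - 1, j}" by auto
    with supp 2 n assms(1) show ?thesis by (cases X) auto
  next
    case 3
    then obtain k where k: "j = Suc k" by (cases j) auto
    with 3 have "{i. i \<le> ?n \<and> (i = j \<or> Suc i = j \<or> i = Suc j)} = {k, Suc k, Suc (Suc k)}"
      by auto
    with supp have "(\<Sum>i\<le>?n. ?f i) = ?f k + ?f (Suc k) + ?f (Suc (Suc k))" by simp
    also have "\<dots> = 0"
      using 3 k by (cases X) simp_all
    finally show ?thesis .
  qed
  then show ?thesis by (simp add: null_root_def)
qed

lemma level_one_iff:
  assumes "admissible X"
  shows "dominant_integral X \<Lambda> \<and> level X \<Lambda> = 1 \<longleftrightarrow>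
    (case X of A_even n \<Rightarrow> \<Lambda> = fundamental_weight 0
             | D_twisted n \<Rightarrow> \<Lambda> \<in> {fundamental_weight 0, fundamental_weight n})"
    (is "?L \<longleftrightarrow> ?R")
proof
  assume ?L
  then obtain c :: "nat \<Rightarrow> nat"
    where c: "\<Lambda> = (\<lambda>h. \<Sum>i\<le>rank X. int (c i) * fundamental_weight i h)"
      and lev: "level X \<Lambda> = 1"
    unfolding dominant_integral_def by blast
  have val: "\<Lambda> (Coroot i) = int (c i)" if "i \<le> rank X" for i
    using that by (simp add: c if_distrib sum.delta cong: if_cong)
  have "level X \<Lambda> = int (\<Sum>i\<le>rank X. comark X i * c i)"
    by (simp add: level_def val)
  with lev have "(\<Sum>i\<le>rank X. comark X i * c i) = 1" by linarith
  then obtain a where a: "a \<le> rank X" "comark X a * c a = 1"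
    and z: "\<And>b. b \<le> rank X \<Longrightarrow> b \<noteq> a \<Longrightarrow> comark X b * c b = 0"
    using sum_eq_1_iff[of "{..rank X}" "\<lambda>i. comark X i * c i"] by auto
  have pos: "comark X b > 0" for b by (cases X) auto
  have c': "c b = (if b = a then 1 else 0)" if "b \<le> rank X" for b
  proof (cases "b = a")
    case True
    with a show ?thesis by simp
  next
    case False
    with z[OF that False] pos[of b] show ?thesis by simp
  qed
  have "\<Lambda> = (\<lambda>h. \<Sum>i\<le>rank X. if i = a then fundamental_weight i h else 0)"
    unfolding c by (intro ext sum.cong) (auto simp: c')
  also have "\<dots> = fundamental_weight a"
    using a(1) by (simp add: sum.delta')
  finally have "\<Lambda> = fundamental_weight a" .
  then show ?R using a by (cases X) (auto split: if_splits)
next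
  assume R: ?R
  then obtain a where \<Lambda>: "\<Lambda> = fundamental_weight a" and a: "a \<le> rank X" "comark X a = 1"
    by (cases X) auto
  have "\<Lambda> = (\<lambda>h. \<Sum>i\<le>rank X. int (if i = a then 1 else 0) * fundamental_weight i h)"
    using a(1) by (simp add: \<Lambda> if_distrib[of int] if_distrib[of "\<lambda>x. x * _"] sum.delta' cong: if_cong)
  then have "dominant_integral X \<Lambda>"
    unfolding dominant_integral_def by (intro exI)
  moreover have "level X \<Lambda> = 1"
    using a by (simp add: level_def \<Lambda> if_distrib[of "\<lambda>x. _ * x"] cong: if_cong)
  ultimately show ?L by simp
qed

lemma block_height_block_color:
  assumes "admissible X"
  shows "block_height X (block_color X \<Lambda> j) =
    (if j mod ell X = 0 \<or> Suc (j mod ell X) = ell X then 1/2 else 1)"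
proof (cases X)
  case (A_even n)
  define r where "r = j mod (2 * n + 1)"
  have "r < 2 * n + 1" unfolding r_def by simp
  then have "stacking X \<Lambda> ! r = (if r \<le> n then r else 2 * n - r)"
    using A_even by (auto simp: nth_append rev_nth nth_Cons')
  then have "block_color X \<Lambda> j = (if r \<le> n then r else 2 * n - r)"
    using A_even by (simp add: block_color_def r_def)
  moreover have "j mod ell X = r" "ell X = 2 * n + 1" using A_even by (simp_all add: r_def)
  moreover have "n \<ge> 1" using A_even assms by simp
  ultimately show ?thesis using A_even \<open>r < 2 * n + 1\<close> by auto
next
  case (D_twisted n)
  define r where "r = j mod (2 * n + 2)"
  have r: "r < 2 * n + 2" unfolding r_def by simp
  define q where "q = j mod (n + 1)"
  have "q = r mod (n + 1)"
    unfolding q_def r_def by (rule mod_mod_cancel[symmetric]) (auto simp: dvd_def intro: exI[of _ 2])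
  then have q: "q = (if r < n + 1 then r else r - (n + 1))" "q < n + 1"
    using r by (simp_all add: mod_if)
  have up: "[0..<n + 1] ! q = q" "rev [0..<n + 1] ! q = n - q"
    using q(2) by (auto simp: rev_nth simp del: upt_Suc)
  have st: "(ys @ zs) ! r \<in> {ys ! q, zs ! q}" if "length ys = n + 1" for ys zs :: "nat list"
    using that q(1) by (simp add: nth_append)
  have "block_color X \<Lambda> j \<in> {q, n - q}"
    using st[of "[0..<n + 1]" "rev [0..<n + 1]"] st[of "rev [0..<n + 1]" "[0..<n + 1]"]
    unfolding up by (auto simp: block_color_def D_twisted r_def simp del: upt_Suc)
  with q(2) have "block_color X \<Lambda> j = 0 \<or> block_color X \<Lambda> j = n \<longleftrightarrow> q = 0 \<or> q = n"
    by (elim insertE emptyE; linarith)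
  moreover have "j mod ell X = q" "ell X = n + 1" using D_twisted by (simp_all add: q_def)
  ultimately show ?thesis using D_twisted by simp
qed

lemma full_column_iff:
  assumes "admissible X" "dominant_integral X \<Lambda>" "level X \<Lambda> = 1"
  shows "full_column X \<Lambda> c \<longleftrightarrow> \<not> ell X dvd c"
proof -
  have ell: "ell X \<ge> 3" using assms(1) by (cases X) auto
  have ground: "block_height X (ground_color X \<Lambda>) = 1/2"
    using assms level_one_iff[of X \<Lambda>] by (cases X) (auto simp: ground_color_def)
  have "\<exists>z :: int. column_height X \<Lambda> c = of_int z + (if ell X dvd c then 1/2 else 0)"
  proof (induction c)
    case 0
    show ?case by (auto simp: column_height_def ground intro: exI[of _ 0])
  next
    case (Suc c)
    then obtain z :: int
      where z: "column_height X \<Lambda> c = of_int z + (if ell X dvd c then 1/2 else 0)" by blast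
    have step: "column_height X \<Lambda> (Suc c) = column_height X \<Lambda> c +
        (if c mod ell X = 0 \<or> Suc (c mod ell X) = ell X then 1/2 else 1)"
      by (simp add: column_height_def block_height_block_color[OF assms(1)])
    have d: "ell X dvd Suc c \<longleftrightarrow> Suc (c mod ell X) = ell X"
      using ell by (auto simp: dvd_eq_mod_eq_0 mod_Suc)
    have e: "ell X dvd c \<longleftrightarrow> c mod ell X = 0" by (simp add: dvd_eq_mod_eq_0)
    show ?case
    proof (cases "Suc (c mod ell X) = ell X")
      case True
      then have "c mod ell X \<noteq> 0" using ell by linarith
      with True show ?thesis by (intro exI[of _ z]) (simp only: step z d e, simp)
    next
      case False
      then show ?thesis by (intro exI[of _ "z + 1"]) (simp only: step z d e, simp)
    qed
  qed
  then obtain z :: int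
    where z: "column_height X \<Lambda> c = of_int z + (if ell X dvd c then 1/2 else 0)" by blast
  have "(of_int z + 1/2 :: real) \<notin> \<int>"
  proof
    assume "(of_int z + 1/2 :: real) \<in> \<int>"
    then obtain w :: int where "(of_int z + 1/2 :: real) = of_int w" by (auto elim: Ints_cases)
    then have "(of_int (2 * z + 1) :: real) = of_int (2 * w)" by simp
    then have "2 * z + 1 = 2 * w" by (simp only: of_int_eq_iff)
    then show False by presburger
  qed
  then show ?thesis unfolding full_column_def z by auto
qed

end

theory Submission
  imports Defs
begin

text \<open>
  A proper Young wall is determined by its multiset of beads, and every finite multiset of
  positive integers in which only multiples of $\ell$ are repeated occurs
  (\<open>bij_betw_beads\<close>). So the walls of weight $\Lambda - m\delta$ have to be
  recognised by their beads.

  Since the Cartan matrix has corank one and the derivation fixes the multiple of $\delta$, the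
  weight is $\Lambda - m\delta$ exactly when the number of added $i$-blocks is $m$ times the
  mark of $i$, for every $i$ (\<open>wt_eq_iff\<close>). The stacking order is a palindrome of
  length $L$: the blocks of one color are those at positions congruent to $p$ or $L - 1 - p$
  modulo $L$, for some $p$. They are counted twice if both residues coincide, which happens for
  the color $n$ of $A_{2n}^{(2)}$ and makes up for its smaller mark. Passing from $p = k$ to $p
  = k - 1$ changes this count in a column of $N$ blocks by $1$ if $N \equiv k$, by $-1$ if $N
  \equiv L - k$, and by $0$ otherwise (\<open>mirror_count_step\<close>). Hence the numbers of
  blocks are proportional to the marks exactly when the runners $R_k$ and $R_{L-k}$ carry
  equally many beads for all $k$. The factor $m$ can then be read off from the blocks in the
  middle of the period, as a sum of contributions of the single beads
  (\<open>wt_iff_balanced_and_energy\<close>): $N/\ell$ for a bead at a multiple $N$ of $\ell$,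
  and otherwise $\epsilon$ times the number of period middles below the bead.

  The beads on $R_k$ and $R_{L-k}$ are two strictly decreasing sequences of the same length,
  which is a partition in Frobenius notation (\<open>frobenius_bij_betw\<close>). Its size is
  the sum of both sequences plus their length, because a hook has one box more than its arm and
  leg together, and this extra box is the extra middle that beads on $R_{L-k}$ have passed. So
  the total contribution of the beads is $m_0 + \epsilon m_1$
  (\<open>multipartition_size_pi_map\<close>). The beads on $R_\ell$ form an arbitrary
  partition, and the contents of $R_\ell$ and of the pairs of runners can be chosen
  independently. This gives a bijection on all balanced walls at once
  (\<open>bij_betw_pi_map\<close>), which is then restricted to the walls of energy $m$.
\<close>

section \<open>Frobenius notation\<close>

text \<open>In $(a|b)$ the entries of \<open>a\<close> are the legs and those of \<open>b\<close> the arms of the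
  hooks based at the diagonal boxes.\<close>

definition frobenius_coordinates :: "nat list \<Rightarrow> nat list \<Rightarrow> bool" where
  "frobenius_coordinates a b \<longleftrightarrow>
    length a = length b \<and> sorted_wrt (>) a \<and> sorted_wrt (>) b"

text \<open>The property by which \<open>frobenius a b\<close> is selected among the partitions.\<close>

definition frobenius_spec :: "nat list \<Rightarrow> nat list \<Rightarrow> nat list \<Rightarrow> bool" where
  "frobenius_spec a b p \<longleftrightarrow>
     length a = diagonal_length p \<and> length b = diagonal_length p \<and>
     (\<forall>k. 1 \<le> k \<and> k \<le> diagonal_length p \<longrightarrow>
        part p k = b ! (k - 1) + k \<and> conjugate_part p k = a ! (k - 1) + k)"

text \<open>The diagram of \<open>q\<close> is moved one step down the diagonal, and a hook with leg \<open>x\<close> and arm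
  \<open>y\<close> is put around it.  The rows of the leg below \<open>q\<close> have length $1$, so the leg comes
  out as \<open>x\<close> when \<open>length q \<le> x\<close>.\<close>

definition add_hook :: "nat \<Rightarrow> nat \<Rightarrow> nat list \<Rightarrow> nat list" where
  "add_hook x y q = Suc y # map Suc q @ replicate (x - length q) 1"

text \<open>The partition with Frobenius notation $(a|b)$, built from the innermost hook outwards.\<close>

fun of_hooks :: "nat list \<Rightarrow> nat list \<Rightarrow> nat list" where
  "of_hooks (x # a) (y # b) = add_hook x y (of_hooks a b)"
| "of_hooks _ _ = []"

lemma part_add_hook_1: "part (add_hook x y q) (Suc 0) = Suc y"
  by (simp add: part_def add_hook_def)

lemma part_add_hook:
  assumes "1 \<le> k" "length q \<le> x"
  shows "part (add_hook x y q) (Suc k) =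
    (if k \<le> length q then Suc (part q k) else if k \<le> x then 1 else 0)"
  using assms by (cases k) (auto simp: part_def add_hook_def nth_append)

lemma part_beyond: "length q < k \<Longrightarrow> part q k = 0"
  by (simp add: part_def)

text \<open>The new corner is a diagonal box, and each old diagonal box has moved by one step.\<close>

lemma diagonal_length_add_hook:
  assumes "length q \<le> x"
  shows "diagonal_length (add_hook x y q) = Suc (diagonal_length q)"
proof -
  let ?D = "\<lambda>p. {k. 1 \<le> k \<and> k \<le> part p k}"
  have "k \<in> ?D (add_hook x y q) \<longleftrightarrow> k \<in> insert 1 (Suc ` ?D q)" for k
  proof (cases k)
    case (Suc j)
    show ?thesis
    proof (cases "j = 0")
      case True
      then show ?thesis using Suc by (simp add: part_add_hook_1)
    next
      case False
      then show ?thesis using Suc part_add_hook[of j q x y] assms part_beyond[of q j]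
        by (auto simp: image_iff)
    qed
  qed simp
  then have "?D (add_hook x y q) = insert 1 (Suc ` ?D q)" by blast
  moreover have "finite (?D q)"
    by (rule finite_subset[of _ "{..length q}"]) (auto simp: part_def split: if_splits)
  moreover have "1 \<notin> Suc ` ?D q" by auto
  ultimately show ?thesis by (simp add: diagonal_length_def card_image)
qed

lemma conjugate_part_add_hook_1:
  assumes "length q \<le> x"
  shows "conjugate_part (add_hook x y q) (Suc 0) = Suc x"
proof -
  have "1 \<le> part (add_hook x y q) i \<longleftrightarrow> i \<in> {1..Suc x}" if "1 \<le> i" for i
  proof (cases "i = 1")
    case True
    then show ?thesis by (simp add: part_add_hook_1)
  next
    case False
    with that obtain j where "i = Suc j" "1 \<le> j" by (cases i) auto
    then show ?thesis using part_add_hook[of j q x y] assms by auto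
  qed
  then have "1 \<le> i \<and> Suc 0 \<le> part (add_hook x y q) i \<longleftrightarrow> i \<in> {1..Suc x}" for i
    by (metis One_nat_def atLeastAtMost_iff)
  then have "{i. 1 \<le> i \<and> Suc 0 \<le> part (add_hook x y q) i} = {1..Suc x}" by blast
  then show ?thesis by (simp add: conjugate_part_def)
qed

text \<open>Column \<open>k\<close> of \<open>q\<close> has become column \<open>k + 1\<close>, with one box of the arm on top; the
  arm reaches that far because \<open>k \<le> y\<close>.\<close>

lemma conjugate_part_add_hook:
  assumes "1 \<le> k" "k \<le> y" "length q \<le> x"
  shows "conjugate_part (add_hook x y q) (Suc k) = Suc (conjugate_part q k)"
proof -
  let ?C = "{i. 1 \<le> i \<and> k \<le> part q i}"
  have "1 \<le> i \<and> Suc k \<le> part (add_hook x y q) i \<longleftrightarrow> i \<in> insert 1 (Suc ` ?C)" for i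
  proof (cases i)
    case (Suc j)
    show ?thesis
    proof (cases "j = 0")
      case True
      then show ?thesis using Suc assms by (simp add: part_add_hook_1)
    next
      case False
      then show ?thesis using Suc part_add_hook[of j q x y] assms part_beyond[of q j]
        by (auto simp: image_iff)
    qed
  qed simp
  then have "{i. 1 \<le> i \<and> Suc k \<le> part (add_hook x y q) i} = insert 1 (Suc ` ?C)" by blast
  moreover have "finite ?C"
    using assms by (intro finite_subset[of ?C "{..length q}"]) (auto simp: part_def split: if_splits)
  moreover have "1 \<notin> Suc ` ?C" by auto
  ultimately show ?thesis by (simp add: conjugate_part_def card_image)
qed

lemma frobenius_coordinates_Cons:
  "frobenius_coordinates (x # a) (y # b) \<longleftrightarrow>
    frobenius_coordinates a b \<and> (\<forall>z\<in>set a. z < x) \<and> (\<forall>z\<in>set b. z < y)"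
  by (auto simp: frobenius_coordinates_def)

text \<open>The outermost leg determines the number of rows.  Since legs decrease strictly, this shows
  that the next hook always fits around the diagram constructed so far.\<close>

lemma length_of_hooks:
  assumes "frobenius_coordinates a b"
  shows "length (of_hooks a b) = (case a of [] \<Rightarrow> 0 | x # _ \<Rightarrow> Suc x)"
  using assms
proof (induction a b rule: of_hooks.induct)
  case (1 x a y b)
  then have "length (of_hooks a b) \<le> x"
    by (auto simp: frobenius_coordinates_Cons split: list.splits)
  then show ?case by (simp add: add_hook_def)
qed (auto simp: frobenius_coordinates_def)

lemma length_of_hooks_le:
  assumes "frobenius_coordinates (x # a) (y # b)"
  shows "length (of_hooks a b) \<le> x"
  using assms length_of_hooks[of a b]
  by (auto simp: frobenius_coordinates_Cons split: list.splits)

text \<open>The bound on the parts is the strengthening that makes the induction work: a new first row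
  must be at least as long as the rows that have been moved to the right.\<close>

lemma is_partition_of_hooks:
  assumes "frobenius_coordinates a b"
  shows "is_partition (of_hooks a b) \<and>
    (\<forall>z\<in>set (of_hooks a b). \<exists>y\<in>set b. z \<le> Suc y)"
  using assms
proof (induction a b rule: of_hooks.induct)
  case (1 x a y b)
  then have q: "is_partition (of_hooks a b)" and y: "\<forall>z\<in>set b. z < y"
    and bound: "\<forall>z\<in>set (of_hooks a b). \<exists>y'\<in>set b. z \<le> Suc y'"
    by (simp_all add: frobenius_coordinates_Cons)
  have le: "\<forall>z\<in>set (of_hooks a b). z \<le> y"
  proof
    fix z assume "z \<in> set (of_hooks a b)"
    with bound obtain y' where "y' \<in> set b" "z \<le> Suc y'" by blast
    with y show "z \<le> y" by (meson Suc_leI le_trans)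
  qed
  have "sorted_wrt (\<ge>) (replicate k (1::nat))" for k by (induction k) auto
  with q le show ?case
    by (auto simp: is_partition_def add_hook_def sorted_wrt_append sorted_wrt_map)
qed (auto simp: is_partition_def)

text \<open>A hook with leg \<open>x\<close> and arm \<open>y\<close> has \<open>x + y + 1\<close> boxes.\<close>

lemma sum_list_of_hooks:
  assumes "frobenius_coordinates a b"
  shows "sum_list (of_hooks a b) = sum_list a + sum_list b + length a"
  using assms
proof (induction a b rule: of_hooks.induct)
  case (1 x a y b)
  have "sum_list (map Suc q) = sum_list q + length q" for q by (induction q) auto
  with 1 length_of_hooks_le[OF 1(2)] show ?case
    by (simp add: frobenius_coordinates_Cons add_hook_def sum_list_replicate)
qed (auto simp: frobenius_coordinates_def)

lemma distinct_if_strictly_decreasing: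
  "sorted_wrt (>) xs \<Longrightarrow> distinct (xs :: nat list)"
  by (induction xs) auto

text \<open>Applied to arms: there are at most as many remaining hooks as boxes in the current arm, so
  every diagonal column of the inner diagram lies below that arm.\<close>

lemma length_le_bound_of_strictly_decreasing:
  fixes b :: "nat list"
  assumes "sorted_wrt (>) b" "\<forall>z\<in>set b. z < y"
  shows "length b \<le> y"
proof -
  have "length b = card (set b)"
    using distinct_if_strictly_decreasing[OF assms(1)] by (simp add: distinct_card)
  also have "\<dots> \<le> card {..<y}" using assms(2) by (intro card_mono) auto
  finally show ?thesis by simp
qed

lemma frobenius_spec_Nil: "frobenius_spec [] [] []"
proof -
  have no_diagonal: "{k. 1 \<le> k \<and> k \<le> part [] k} = {}" by (auto simp: part_def)
  have "diagonal_length [] = 0" unfolding diagonal_length_def no_diagonal by simp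
  then show ?thesis by (simp add: frobenius_spec_def)
qed

lemma frobenius_spec_of_hooks:
  assumes "frobenius_coordinates a b"
  shows "frobenius_spec a b (of_hooks a b)"
  using assms
proof (induction a b rule: of_hooks.induct)
  case (1 x a y b)
  let ?q = "of_hooks a b"
  have ab: "frobenius_coordinates a b" and y: "\<forall>z\<in>set b. z < y"
    using 1(2) by (auto simp: frobenius_coordinates_Cons)
  note IH = 1(1)[OF ab]
  have le: "length ?q \<le> x" by (rule length_of_hooks_le[OF 1(2)])
  have "length b \<le> y"
    using ab y by (intro length_le_bound_of_strictly_decreasing) (auto simp: frobenius_coordinates_def)
  then have dy: "diagonal_length ?q \<le> y" using IH by (simp add: frobenius_spec_def)
  have "part (add_hook x y ?q) k = (y # b) ! (k - 1) + k \<and>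
      conjugate_part (add_hook x y ?q) k = (x # a) ! (k - 1) + k"
    if k: "1 \<le> k" "k \<le> Suc (diagonal_length ?q)" for k
  proof (cases "k = 1")
    case True
    then show ?thesis by (simp add: part_add_hook_1 conjugate_part_add_hook_1[OF le])
  next
    case False
    with k obtain j where j: "k = Suc j" "1 \<le> j" "j \<le> diagonal_length ?q" by (cases k) auto
    have p: "part ?q j = b ! (j - 1) + j" "conjugate_part ?q j = a ! (j - 1) + j"
      using IH j by (auto simp: frobenius_spec_def)
    then have "j \<le> length ?q" using part_beyond[of ?q j] j by (cases "j \<le> length ?q") auto
    then show ?thesis
      using j p le dy part_add_hook[of j ?q x y] conjugate_part_add_hook[of j y ?q x]
      by (simp add: nth_Cons')
  qed
  then show ?case
    using IH by (simp add: frobenius_spec_def diagonal_length_add_hook[OF le])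
next
  case ("2_1" b)
  then have "b = []" by (simp add: frobenius_coordinates_def)
  then show ?case using frobenius_spec_Nil by simp
next
  case ("2_2" a)
  then have "a = []" by (simp add: frobenius_coordinates_def)
  then show ?case using frobenius_spec_Nil by simp
qed

text \<open>Arms and legs can be read off from a partition.  This is the injectivity of the Frobenius
  notation.\<close>

lemma frobenius_spec_unique:
  assumes "frobenius_spec a b p" "frobenius_spec a' b' p"
  shows "a = a' \<and> b = b'"
proof -
  let ?d = "diagonal_length p"
  have len: "length a = ?d" "length b = ?d" "length a' = ?d" "length b' = ?d"
    using assms by (auto simp: frobenius_spec_def)
  have "a ! i = a' ! i \<and> b ! i = b' ! i" if "i < ?d" for i
  proof -
    have i: "1 \<le> Suc i" "Suc i \<le> ?d" using that by auto
    have "part p (Suc i) = b ! i + Suc i" "part p (Suc i) = b' ! i + Suc i"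
        "conjugate_part p (Suc i) = a ! i + Suc i" "conjugate_part p (Suc i) = a' ! i + Suc i"
      using assms i unfolding frobenius_spec_def by (metis diff_Suc_1)+
    then show ?thesis by simp
  qed
  then show ?thesis using len by (auto intro: nth_equalityI)
qed

text \<open>Removing the first column deletes the rows of length $1$; they stand at the end, so their
  number is enough to restore them.\<close>

lemma partition_eq_big_parts_and_ones:
  assumes "is_partition r"
  shows "r = filter ((<) 1) r @ replicate (length r - length (filter ((<) 1) r)) 1"
  using assms
proof (induction r)
  case (Cons z r)
  show ?case
  proof (cases "1 < z")
    case True
    with Cons show ?thesis by (simp add: is_partition_def)
  next
    case False
    with Cons(2) have "z = 1" "\<forall>w\<in>set r. w = 1"
      by (auto simp: is_partition_def Suc_le_eq)
        (metis One_nat_def Suc_leI less_one nat_less_le)+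
    then have "z # r = replicate (Suc (length r)) 1" "filter ((<) 1) (z # r) = []"
      by (auto simp: replicate_length_same filter_empty_conv)
    then show ?thesis by simp
  qed
qed simp

text \<open>Removing the first row and the first column of a partition leaves a partition with fewer rows,
  and the removed hook has a longer arm and a longer leg than the hooks that remain.\<close>

lemma of_hooks_surj:
  assumes "is_partition p"
  shows "\<exists>a b. frobenius_coordinates a b \<and> of_hooks a b = p"
  using assms
proof (induction "length p" arbitrary: p rule: less_induct)
  case less
  show ?case
  proof (cases p)
    case Nil
    then show ?thesis by (intro exI[of _ "[]"]) (simp add: frobenius_coordinates_def)
  next
    case (Cons z r)
    \<comment> \<open>the diagram without its first row and first column\<close>
    define q where "q = map (\<lambda>w. w - 1) (filter ((<) 1) r)"
    have r: "is_partition r" and z: "0 < z" "\<forall>w\<in>set r. w \<le> z"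
      using less(2) Cons by (auto simp: is_partition_def)
    have q: "is_partition q"
    proof -
      have "sorted_wrt (\<lambda>v w. w - 1 \<le> v - 1) (filter ((<) 1) r)"
        by (rule sorted_wrt_mono_rel[of _ "(\<ge>)"])
          (use r in \<open>auto simp: is_partition_def sorted_wrt_filter\<close>)
      then show ?thesis by (auto simp: q_def is_partition_def sorted_wrt_map)
    qed
    have lq: "length q \<le> length r" by (simp add: q_def)
    then have "length q < length p" using Cons by simp
    from less(1)[OF this q] obtain a b
      where ab: "frobenius_coordinates a b" "of_hooks a b = q" by blast
    have "map Suc q = filter ((<) 1) r"
      unfolding q_def map_map by (rule map_idI) auto
    moreover have "length q = length (filter ((<) 1) r)" by (simp add: q_def)
    ultimately have "map Suc q @ replicate (length r - length q) 1 = r"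
      using partition_eq_big_parts_and_ones[OF r] by metis
    then have p: "add_hook (length r) (z - 1) q = p"
      using Cons z(1) by (simp add: add_hook_def)
    have "\<forall>x\<in>set a. x < length r"
      using length_of_hooks[OF ab(1)] ab lq
      by (cases a) (fastforce simp: frobenius_coordinates_def)+
    moreover have "\<forall>y\<in>set b. y < z - 1"
    proof (cases b)
      case (Cons y b')
      then obtain x a' where "a = x # a'" using ab by (cases a) (auto simp: frobenius_coordinates_def)
      then have "Suc y \<in> set q" using ab Cons by (auto simp: add_hook_def)
      then have "y < z - 1" using z(2) by (auto simp: q_def)
      then show ?thesis using ab(1) Cons by (auto simp: frobenius_coordinates_def)
    qed simp
    ultimately have "frobenius_coordinates (length r # a) ((z - 1) # b)"
      using ab by (simp add: frobenius_coordinates_Cons)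
    then show ?thesis using p ab by (metis of_hooks.simps(1))
  qed
qed

text \<open>A partition that satisfies the specification is itself built from hooks, and its hooks can only
  be the given ones; so the definite description is meaningful.\<close>

lemma frobenius_eq_of_hooks:
  assumes "frobenius_coordinates a b"
  shows "frobenius a b = of_hooks a b"
proof -
  have "frobenius a b = (THE p. is_partition p \<and> frobenius_spec a b p)"
    by (simp add: frobenius_def frobenius_spec_def)
  also have "\<dots> = of_hooks a b"
  proof (rule the_equality)
    show "is_partition (of_hooks a b) \<and> frobenius_spec a b (of_hooks a b)"
      using is_partition_of_hooks frobenius_spec_of_hooks assms by blast
  next
    fix p assume p: "is_partition p \<and> frobenius_spec a b p"
    then obtain a' b' where ab': "frobenius_coordinates a' b'" "of_hooks a' b' = p"
      using of_hooks_surj by blast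
    then have "frobenius_spec a' b' p" using frobenius_spec_of_hooks by blast
    with p have "a = a' \<and> b = b'" using frobenius_spec_unique by blast
    with ab' show "p = of_hooks a b" by simp
  qed
  finally show ?thesis .
qed

lemma frobenius_bij_betw:
  "bij_betw (\<lambda>(a, b). frobenius a b) {(a, b). frobenius_coordinates a b} {p. is_partition p}"
proof -
  have "inj_on (\<lambda>(a, b). frobenius a b) {(a, b). frobenius_coordinates a b}"
  proof (rule inj_onI, clarsimp simp: frobenius_eq_of_hooks)
    fix a b a' b'
    assume ab: "frobenius_coordinates a b" "frobenius_coordinates a' b'"
      and eq: "of_hooks a b = of_hooks a' b'"
    show "a = a' \<and> b = b'"
      using frobenius_spec_of_hooks[OF ab(1)] frobenius_spec_of_hooks[OF ab(2)]
      unfolding eq by (rule frobenius_spec_unique)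
  qed
  moreover have "(\<lambda>(a, b). frobenius a b) ` {(a, b). frobenius_coordinates a b} = {p. is_partition p}"
  proof (intro equalityI subsetI)
    fix p assume "p \<in> {p. is_partition p}"
    then obtain a b where "frobenius_coordinates a b" "of_hooks a b = p"
      using of_hooks_surj by blast
    then show "p \<in> (\<lambda>(a, b). frobenius a b) ` {(a, b). frobenius_coordinates a b}"
      by (intro image_eqI[of _ _ "(a, b)"]) (simp_all add: frobenius_eq_of_hooks)
  qed (auto simp: frobenius_eq_of_hooks is_partition_of_hooks)
  ultimately show ?thesis by (simp add: bij_betw_def)
qed

lemma sum_list_frobenius:
  assumes "frobenius_coordinates a b"
  shows "sum_list (frobenius a b) = sum_list a + sum_list b + length a"
  using assms by (simp add: frobenius_eq_of_hooks sum_list_of_hooks)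

section \<open>Proper Young walls as multisets of beads\<close>

lemma strict_mono_column_height: "strict_mono (column_height X \<Lambda>)"
proof -
  have "block_height X i > 0" for i by (cases X) auto
  then show ?thesis by (simp add: strict_mono_Suc_iff column_height_def)
qed

lemma column_height_le_iff: "column_height X \<Lambda> c \<le> column_height X \<Lambda> d \<longleftrightarrow> c \<le> d"
  by (rule strict_mono_less_eq[OF strict_mono_column_height])

lemma column_height_eq_iff: "column_height X \<Lambda> c = column_height X \<Lambda> d \<longleftrightarrow> c = d"
  by (rule strict_mono_eq[OF strict_mono_column_height])

lemma count_beads:
  assumes "finite {k. Y k \<noteq> 0}" "N \<noteq> 0"
  shows "count (beads Y) N = card {k. Y k = N}"
proof -
  have "count (beads Y) N = (\<Sum>k\<in>{k. Y k = N}. count (mset_set {k. Y k \<noteq> 0}) k)"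
    unfolding beads_def count_image_mset using assms
    by (intro sum.cong) auto
  also have "\<dots> = (\<Sum>k\<in>{k. Y k = N}. 1)"
    using assms by (intro sum.cong) (auto simp: count_mset_set)
  finally show ?thesis by simp
qed

lemma zero_notin_beads: "finite {k. Y k \<noteq> 0} \<Longrightarrow> 0 \<notin># beads Y"
  by (auto simp: beads_def)

definition partition_wall :: "wall \<Rightarrow> bool" where
  "partition_wall Y \<longleftrightarrow> finite {k. Y k \<noteq> 0} \<and> antimono Y"

definition proper_beads :: "affine_type \<Rightarrow> nat multiset \<Rightarrow> bool" where
  "proper_beads X M \<longleftrightarrow> 0 \<notin># M \<and> (\<forall>N. \<not> ell X dvd N \<longrightarrow> count M N \<le> 1)"

text \<open>Heights increase strictly with the number of added blocks, so heights can be replaced by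
  numbers of blocks.  A column is full when \<open>ell X\<close> does not divide its number of blocks, and
  then at most one column may have that number.\<close>

lemma proper_young_wall_iff:
  assumes "admissible X" "dominant_integral X \<Lambda>" "level X \<Lambda> = 1"
  shows "proper_young_wall X \<Lambda> Y \<longleftrightarrow> partition_wall Y \<and> proper_beads X (beads Y)"
proof (cases "finite {k. Y k \<noteq> 0}")
  case True
  have distinct: "(\<forall>j k. j \<noteq> k \<and> \<not> ell X dvd Y j \<and> \<not> ell X dvd Y k \<longrightarrow> Y j \<noteq> Y k) \<longleftrightarrow>
      (\<forall>N. \<not> ell X dvd N \<longrightarrow> count (beads Y) N \<le> 1)" (is "?L \<longleftrightarrow> ?R")
  proof -
    have fin: "finite {k. Y k = N}" if "N \<noteq> 0" for N
      by (rule finite_subset[OF _ True]) (use that in auto)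
    have nz: "N \<noteq> 0" if "\<not> ell X dvd N" for N using that by (cases N) auto
    have le1: "card {k. Y k = N} \<le> 1 \<longleftrightarrow> (\<forall>j k. Y j = N \<and> Y k = N \<longrightarrow> j = k)" if "N \<noteq> 0" for N
      using card_le_Suc0_iff_eq[OF fin[OF that]] by auto
    have "count (beads Y) N \<le> 1 \<longleftrightarrow> (\<forall>j k. Y j = N \<and> Y k = N \<longrightarrow> j = k)"
      if "\<not> ell X dvd N" for N
      unfolding count_beads[OF True nz[OF that]] by (rule le1[OF nz[OF that]])
    then have "?R \<longleftrightarrow> (\<forall>N. \<not> ell X dvd N \<longrightarrow> (\<forall>j k. Y j = N \<and> Y k = N \<longrightarrow> j = k))"
      by simp
    then show ?thesis by metis
  qed
  have decreasing: "(\<forall>j k. j \<le> k \<longrightarrow> Y k \<le> Y j) \<longleftrightarrow> antimono Y"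
    by (auto simp: antimono_def)
  show ?thesis
    unfolding proper_young_wall_def young_wall_def full_column_iff[OF assms]
      column_height_le_iff column_height_eq_iff distinct decreasing proper_beads_def partition_wall_def
    using True zero_notin_beads[OF True] by simp
qed (simp add: proper_young_wall_def young_wall_def partition_wall_def)

lemma rev_sorted_list_of_multiset_mset:
  fixes xs :: "nat list"
  assumes "sorted_wrt (\<ge>) xs"
  shows "rev (sorted_list_of_multiset (mset xs)) = xs"
proof -
  have "sorted (rev xs)" using assms by (simp add: sorted_wrt_rev)
  then have "sort xs = rev xs" by (intro properties_for_sort) simp_all
  then show ?thesis by simp
qed

lemma sorted_rev_sorted_list_of_multiset:
  "sorted_wrt (\<ge>) (rev (sorted_list_of_multiset (M :: nat multiset)))"
  by (simp add: sorted_wrt_rev)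

definition wall_with_beads :: "nat multiset \<Rightarrow> wall" where
  "wall_with_beads M k =
    (if k < size M then rev (sorted_list_of_multiset M) ! k else 0)"

lemma length_sorted_list_of_multiset: "length (sorted_list_of_multiset M) = size M"
  by (metis mset_sorted_list_of_multiset size_mset)

lemma partition_wall_wall_with_beads: "partition_wall (wall_with_beads M)"
proof -
  have "{k. wall_with_beads M k \<noteq> 0} \<subseteq> {..<size M}"
    by (auto simp: wall_with_beads_def split: if_splits)
  then have "finite {k. wall_with_beads M k \<noteq> 0}" by (rule finite_subset) simp
  moreover have "antimono (wall_with_beads M)"
  proof (rule antimonoI)
    fix j k :: nat assume "j \<le> k"
    then show "wall_with_beads M k \<le> wall_with_beads M j"
      using sorted_wrt_nth_less[OF sorted_rev_sorted_list_of_multiset, of j k M]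
      by (cases "j = k") (auto simp: wall_with_beads_def length_sorted_list_of_multiset)
  qed
  ultimately show ?thesis by (simp add: partition_wall_def)
qed

lemma beads_wall_with_beads:
  assumes "0 \<notin># M"
  shows "beads (wall_with_beads M) = M"
proof -
  let ?xs = "rev (sorted_list_of_multiset M)"
  have len: "length ?xs = size M" by (simp add: length_sorted_list_of_multiset)
  have "?xs ! k \<noteq> 0" if "k < size M" for k
    using that len assms nth_mem[of k ?xs] by (metis set_rev set_sorted_list_of_multiset)
  then have "{k. wall_with_beads M k \<noteq> 0} = {..<size M}"
    by (auto simp: wall_with_beads_def)
  then have "beads (wall_with_beads M) = image_mset (wall_with_beads M) (mset_set {..<size M})"
    by (simp add: beads_def)
  also have "\<dots> = image_mset (\<lambda>k. ?xs ! k) (mset_set {..<size M})"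
    by (intro image_mset_cong) (simp add: wall_with_beads_def)
  also have "\<dots> = mset (map (\<lambda>k. ?xs ! k) [0..<length ?xs])"
    by (simp add: length_sorted_list_of_multiset atLeast0LessThan)
  also have "\<dots> = M" unfolding map_nth by simp
  finally show ?thesis .
qed

lemma wall_with_beads_beads:
  assumes "partition_wall Y"
  shows "wall_with_beads (beads Y) = Y"
proof -
  let ?S = "{k. Y k \<noteq> 0}"
  have fin: "finite ?S" and anti: "antimono Y" using assms by (auto simp: partition_wall_def)
  have "?S = {..<card ?S}"
  proof -
    have down: "j \<in> ?S" if "k \<in> ?S" "j \<le> k" for j k
      using antimonoD[OF anti that(2)] that(1) by auto
    have "\<exists>d. ?S = {..<d}"
    proof (cases "?S = {}")
      case True
      then show ?thesis by (intro exI[of _ 0]) simp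
    next
      case False
      have "?S = {..Max ?S}"
      proof (intro equalityI subsetI)
        fix k assume "k \<in> ?S"
        then show "k \<in> {..Max ?S}" using Max_ge[OF fin] by blast
      next
        fix k assume "k \<in> {..Max ?S}"
        then show "k \<in> ?S" using down[OF Max_in[OF fin False]] by blast
      qed
      then show ?thesis by (metis lessThan_Suc_atMost)
    qed
    then show ?thesis by (metis card_lessThan)
  qed
  then obtain d where S: "?S = {..<d}" by blast
  have mset: "beads Y = mset (map Y [0..<d])" unfolding beads_def S by (simp add: atLeast0LessThan)
  have "sorted_wrt (\<ge>) (map Y [0..<d])"
    using antimonoD[OF anti] by (auto simp: sorted_wrt_iff_nth_less)
  then have "rev (sorted_list_of_multiset (beads Y)) = map Y [0..<d]"
    unfolding mset by (rule rev_sorted_list_of_multiset_mset)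
  moreover have "size (beads Y) = d" by (simp add: mset)
  moreover have "Y k = 0" if "\<not> k < d" for k using S that by blast
  ultimately show ?thesis by (auto simp: wall_with_beads_def)
qed

text \<open>A weakly decreasing sequence is recovered by sorting its multiset of nonzero values.\<close>

lemma bij_betw_beads:
  assumes "admissible X" "dominant_integral X \<Lambda>" "level X \<Lambda> = 1"
  shows "bij_betw beads {Y. proper_young_wall X \<Lambda> Y} {M. proper_beads X M}"
  by (rule bij_betw_byWitness[where f' = wall_with_beads])
    (auto simp: proper_young_wall_iff[OF assms] wall_with_beads_beads beads_wall_with_beads
      partition_wall_wall_with_beads proper_beads_def)

section \<open>The weight of a wall in terms of its beads\<close>

lemma type_parameters:
  assumes "admissible X"
  shows "1 \<le> rank X"
    and "period X = 2 * rank X + 1 \<and> ell X = period X \<and> eps X = 1 \<or>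
         period X = 2 * rank X + 2 \<and> ell X = rank X + 1 \<and> eps X = 2"
  using assms by (cases X; simp)+

lemma ell_pos: "admissible X \<Longrightarrow> 0 < ell X"
  by (cases X) auto

text \<open>The Cartan matrix is tridiagonal with nonzero entries next to the diagonal.  Row \<open>j\<close>
  therefore determines \<open>d (j + 1)\<close> from the preceding values.\<close>

lemma cartan_kernel:
  fixes d :: "nat \<Rightarrow> int"
  assumes "admissible X" "\<And>j. j \<le> rank X \<Longrightarrow> (\<Sum>i\<le>rank X. d i * cartan X j i) = 0" "d 0 = 0"
    and "i \<le> rank X"
  shows "d i = 0"
  using \<open>i \<le> rank X\<close>
proof (induction i rule: less_induct)
  case (less i)
  show ?case
  proof (cases i)
    case 0
    then show ?thesis by (simp add: assms(3))
  next
    case (Suc j)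
    have far: "cartan X j i' = 0" if "Suc j < i'" for i' using that by (cases X) auto
    have "d i' * cartan X j i' = 0" if "i' \<noteq> Suc j" "i' \<le> rank X" for i'
      using less.IH[of i'] far[of i'] that Suc by (cases "i' < Suc j") auto
    then have "(\<Sum>i\<le>rank X. d i * cartan X j i) = (\<Sum>i\<in>{Suc j}. d i * cartan X j i)"
      using less.prems Suc by (intro sum.mono_neutral_right) auto
    moreover have "cartan X j (Suc j) \<noteq> 0"
      using less.prems Suc by (cases X) auto
    ultimately show ?thesis using assms(2)[of j] less.prems Suc by simp
  qed
qed

text \<open>Values on the coroots determine the numbers of blocks up to a multiple of the null root, and
  the value on the derivation fixes this multiple.\<close>

lemma wt_eq_iff:
  assumes "admissible X"
  shows "wt X \<Lambda> Y = (\<lambda>h. \<Lambda> h - int m * null_root X h) \<longleftrightarrow>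
    (\<forall>i\<le>rank X. added_blocks X \<Lambda> Y i = m * mark X i)" (is "?L \<longleftrightarrow> ?R")
proof
  assume ?R
  then have "(\<Sum>i\<le>rank X. int (added_blocks X \<Lambda> Y i) * simple_root X i h) = int m * null_root X h" for h
    unfolding null_root_def sum_distrib_left by (intro sum.cong) simp_all
  then show ?L by (simp add: wt_def)
next
  assume ?L
  define d where "d i = int (added_blocks X \<Lambda> Y i) - int (m * mark X i)" for i
  have eq: "(\<Sum>i\<le>rank X. d i * simple_root X i h) = 0" for h
  proof -
    have "(\<Sum>i\<le>rank X. int (added_blocks X \<Lambda> Y i) * simple_root X i h) =
        (\<Sum>i\<le>rank X. int (m * mark X i) * simple_root X i h)"
      using fun_cong[OF \<open>?L\<close>, of h]
      by (simp add: wt_def null_root_def sum_distrib_left mult.assoc)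
    then show ?thesis by (simp add: d_def left_diff_distrib sum_subtractf)
  qed
  have "(\<Sum>i\<le>rank X. d i * simple_root X i Derivation) = d 0"
    by (simp add: if_distrib[of "\<lambda>x. _ * x"] cong: if_cong)
  then have "d 0 = 0" using eq[of Derivation] by simp
  moreover have "(\<Sum>i\<le>rank X. d i * cartan X j i) = 0" for j
    using eq[of "Coroot j"] by simp
  ultimately have "d i = 0" if "i \<le> rank X" for i
    using cartan_kernel[OF assms, of d i] that by blast
  then have "int (added_blocks X \<Lambda> Y i) = int (m * mark X i)" if "i \<le> rank X" for i
    using that unfolding d_def by (metis eq_iff_diff_eq_0)
  then show ?R unfolding of_nat_eq_iff by blast
qed

definition color_count :: "affine_type \<Rightarrow> weight \<Rightarrow> nat \<Rightarrow> nat \<Rightarrow> nat" where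
  "color_count X \<Lambda> i N = card {j. j < N \<and> block_color X \<Lambda> j = i}"

lemma added_blocks_eq_sum_beads:
  assumes "finite {k. Y k \<noteq> 0}"
  shows "added_blocks X \<Lambda> Y i = (\<Sum>N\<in>#beads Y. color_count X \<Lambda> i N)"
proof -
  have "{(k, j). j < Y k \<and> block_color X \<Lambda> j = i} =
      Sigma {k. Y k \<noteq> 0} (\<lambda>k. {j. j < Y k \<and> block_color X \<Lambda> j = i})"
    by auto
  then have "added_blocks X \<Lambda> Y i = (\<Sum>k | Y k \<noteq> 0. color_count X \<Lambda> i (Y k))"
    using assms by (simp add: added_blocks_def color_count_def card_SigmaI)
  then show ?thesis by (simp add: beads_def sum_unfold_sum_mset image_mset.compositionality o_def)
qed

definition residue_count :: "nat \<Rightarrow> nat \<Rightarrow> nat \<Rightarrow> nat" where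
  "residue_count L p N = card {j. j < N \<and> j mod L = p}"

lemma residue_count_0: "residue_count L p 0 = 0"
  by (simp add: residue_count_def)

lemma residue_count_Suc:
  "residue_count L p (Suc N) = residue_count L p N + (if N mod L = p then 1 else 0)"
proof -
  have "{j. j < Suc N \<and> j mod L = p} =
      (if N mod L = p then insert N {j. j < N \<and> j mod L = p} else {j. j < N \<and> j mod L = p})"
    by (auto simp: less_Suc_eq)
  then show ?thesis by (simp add: residue_count_def)
qed

lemma residue_count_eq:
  assumes "p < L"
  shows "residue_count L p N = N div L + (if p < N mod L then 1 else 0)"
proof (induction N)
  case 0
  then show ?case by (simp add: residue_count_0)
next
  case (Suc N)
  show ?case
  proof (cases "Suc (N mod L) = L")
    case True
    then have "Suc N mod L = 0" "Suc N div L = Suc (N div L)"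
      by (simp_all add: mod_Suc div_Suc)
    then show ?thesis using Suc True assms by (auto simp: residue_count_Suc)
  next
    case False
    then have "Suc N mod L = Suc (N mod L)" "Suc N div L = N div L"
      by (simp_all add: mod_Suc div_Suc)
    then show ?thesis using Suc assms by (auto simp: residue_count_Suc)
  qed
qed

text \<open>The number of blocks, in a column of \<open>N\<close> added blocks, at the positions that are congruent
  to \<open>p\<close> or to its mirror image under the symmetry of the stacking order.  For the middle position
  of an odd period, which is its own mirror image, every block is counted twice.\<close>

definition mirror_count :: "affine_type \<Rightarrow> nat \<Rightarrow> nat \<Rightarrow> nat" where
  "mirror_count X p N =
    residue_count (period X) p N + residue_count (period X) (period X - 1 - p) N"

text \<open>The first position, within a period, of a block of the given color.\<close>

definition color_residue :: "affine_type \<Rightarrow> weight \<Rightarrow> nat \<Rightarrow> nat" where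
  "color_residue X \<Lambda> i =
    (case X of A_even n \<Rightarrow> i | D_twisted n \<Rightarrow> if \<Lambda> = fundamental_weight 0 then i else n - i)"

text \<open>The stacking order is a palindrome.\<close>

lemma block_color_eq_iff:
  assumes "admissible X" "i \<le> rank X"
  shows "block_color X \<Lambda> j = i \<longleftrightarrow>
    j mod period X = color_residue X \<Lambda> i \<or>
    j mod period X = period X - 1 - color_residue X \<Lambda> i"
proof (cases X)
  case (A_even n)
  define r where "r = j mod (2 * n + 1)"
  have "r < 2 * n + 1" unfolding r_def by simp
  then have "stacking X \<Lambda> ! r = (if r \<le> n then r else 2 * n - r)"
    using A_even by (auto simp: nth_append rev_nth nth_Cons')
  then have "block_color X \<Lambda> j = (if r \<le> n then r else 2 * n - r)"
    using A_even by (simp add: block_color_def r_def)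
  moreover have "j mod period X = r" "period X - 1 = 2 * n" "color_residue X \<Lambda> i = i" "i \<le> n"
    using A_even assms by (simp_all add: r_def color_residue_def)
  ultimately show ?thesis using \<open>r < 2 * n + 1\<close> by auto
next
  case (D_twisted n)
  define r where "r = j mod (2 * n + 2)"
  have r: "r < 2 * n + 2" unfolding r_def by simp
  \<comment> \<open>the color at residue \<open>r\<close> when the stacking starts with color $0$\<close>
  define u where "u = (if r \<le> n then r else 2 * n + 1 - r)"
  have u: "u \<le> n" using r by (auto simp: u_def)
  have "([0..<n + 1] @ rev [0..<n + 1]) ! r = u" "(rev [0..<n + 1] @ [0..<n + 1]) ! r = n - u"
    using r by (auto simp: nth_append rev_nth u_def simp del: upt_Suc)
  then have "block_color X \<Lambda> j = (if \<Lambda> = fundamental_weight 0 then u else n - u)"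
    using D_twisted by (simp add: block_color_def r_def del: upt_Suc)
  then have "block_color X \<Lambda> j = i \<longleftrightarrow> u = color_residue X \<Lambda> i"
    using u assms D_twisted by (auto simp: color_residue_def)
  also have "\<dots> \<longleftrightarrow> r = color_residue X \<Lambda> i \<or> r = 2 * n + 1 - color_residue X \<Lambda> i"
    using r assms D_twisted by (auto simp: u_def color_residue_def)
  finally show ?thesis using D_twisted by (simp add: r_def)
qed

text \<open>The factor \<open>eps X * mark X i\<close> is $2$, except for the color in the middle of the odd period of
  $A_{2n}^{(2)}$.  There it is $1$, which compensates the double count.\<close>

lemma color_count_eq_mirror_count:
  assumes "admissible X" "i \<le> rank X"
  shows "2 * color_count X \<Lambda> i N = eps X * mark X i * mirror_count X (color_residue X \<Lambda> i) N"
proof -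
  let ?L = "period X" and ?p = "color_residue X \<Lambda> i"
  let ?R = "\<lambda>p. {j. j < N \<and> j mod ?L = p}"
  have split: "{j. j < N \<and> block_color X \<Lambda> j = i} = ?R ?p \<union> ?R (?L - 1 - ?p)"
    using block_color_eq_iff[OF assms] by auto
  show ?thesis
  proof (cases "?p = ?L - 1 - ?p")
    case True
    then have "color_count X \<Lambda> i N = residue_count ?L ?p N"
      unfolding color_count_def split residue_count_def by simp
    moreover have "mirror_count X ?p N = 2 * residue_count ?L ?p N"
      using True unfolding mirror_count_def by simp
    moreover have "eps X * mark X i = 1"
    proof (cases X)
      case (A_even n)
      with True assms have "i = n" by (simp add: color_residue_def)
      with A_even show ?thesis by simp
    next
      case (D_twisted n)
      with assms have "?p \<le> n" by (auto simp: color_residue_def)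
      moreover have "?p = 2 * n + 1 - ?p" using True D_twisted by simp
      ultimately have False by presburger
      then show ?thesis ..
    qed
    ultimately show ?thesis by simp
  next
    case False
    then have "?R ?p \<inter> ?R (?L - 1 - ?p) = {}" by auto
    then have "color_count X \<Lambda> i N = mirror_count X ?p N"
      unfolding color_count_def split mirror_count_def residue_count_def
      by (intro card_Un_disjoint) auto
    moreover have "eps X * mark X i = 2"
      using False assms by (cases X) (auto simp: color_residue_def)
    ultimately show ?thesis by simp
  qed
qed

text \<open>Within a period the residues \<open>k - 1\<close>, \<open>k\<close> are consecutive, and so are their mirror images
  $L - 1 - k$, $L - k$.  A column whose top lies between the first two has one more block of class
  \<open>k - 1\<close> than of class \<open>k\<close>; one whose top lies between the other two has one less.  Hence the
  beads on $R_k$ and $R_{L-k}$ measure the difference of the counts for two adjacent classes.  In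
  the equation the negative terms are moved to the other side.\<close>

lemma mirror_count_step:
  assumes "1 \<le> k" "k < period X"
  shows "mirror_count X (k - 1) N + (if N mod period X = period X - k then 1 else 0) =
         mirror_count X k N + (if N mod period X = k then 1 else 0)"
proof (induction N)
  case 0
  with assms show ?case by (simp add: mirror_count_def residue_count_0)
next
  case (Suc N)
  let ?L = "period X"
  obtain k' where k': "k = Suc k'" using assms by (cases k) auto
  have "(if Suc N mod ?L = ?L - k then 1 else 0 :: nat) = (if N mod ?L = ?L - 1 - k then 1 else 0)"
       "(if Suc N mod ?L = k then 1 else 0 :: nat) = (if N mod ?L = k - 1 then 1 else 0)"
    using assms by (auto simp: mod_Suc)
  with Suc show ?case by (simp add: mirror_count_def residue_count_Suc k')
qed

text \<open>Summed over the beads of a wall of weight $\Lambda - m\delta$, this gives $m$.\<close>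

definition bead_energy :: "affine_type \<Rightarrow> nat \<Rightarrow> nat" where
  "bead_energy X N = (if ell X dvd N then N div ell X
     else eps X * (N div period X + (if rank X < N mod period X then 1 else 0)))"

text \<open>For $p = n$ the two residues are in the middle of the period.  In an odd period they coincide,
  so that the count is twice the number of middles passed by the bead.  In an even period they are
  adjacent, on either side of the boundary between two halves of length $\ell$: a bead at an odd
  multiple of $\ell$ has passed one of the two in the current period, any other bead both or none.\<close>

lemma bead_energy_eq_mirror_count:
  assumes "admissible X"
  shows "2 * bead_energy X N = eps X * mirror_count X (rank X) N"
  using type_parameters(2)[OF assms]
proof (elim disjE conjE)
  assume X: "period X = 2 * rank X + 1" "ell X = period X" "eps X = 1"
  then show ?thesis
    by (auto simp: bead_energy_def mirror_count_def residue_count_eq mod_eq_0_iff_dvd[symmetric])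
next
  assume X: "period X = 2 * rank X + 2" "ell X = rank X + 1" "eps X = 2"
  let ?n = "rank X"
  \<comment> \<open>a period consists of two halves of length $\ell = n + 1$\<close>
  define q r where "q = N div (2 * ?n + 2)" and "r = N mod (2 * ?n + 2)"
  have N: "N = (2 * q) * (?n + 1) + r" and r: "r < 2 * ?n + 2"
    using div_mult_mod_eq[of N "2 * ?n + 2"] by (simp_all add: q_def r_def algebra_simps)
  have "bead_energy X N = 2 * q + (if ?n < r then 1 else 0) + (if Suc ?n < r then 1 else 0)"
  proof (cases "?n + 1 dvd N")
    case True
    then have "?n + 1 dvd r" using N by (metis dvd_add_right_iff dvd_triv_right)
    then obtain t where t: "r = (?n + 1) * t" by blast
    with r have "(?n + 1) * t < (?n + 1) * 2" by simp
    then have "t < 2" using mult_less_cancel1 by blast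
    then have "r = 0 \<or> r = ?n + 1" using t by (cases t) (auto simp: less_Suc_eq)
    moreover have "N = (2 * q + t) * (?n + 1)" using N t by (simp add: algebra_simps)
    then have "N div (?n + 1) = 2 * q + t" by (metis nonzero_mult_div_cancel_right add_is_0 one_neq_zero)
    moreover have "t = 0 \<or> t = 1" using \<open>t < 2\<close> by auto
    ultimately show ?thesis using True X t by (auto simp: bead_energy_def)
  next
    case False
    have "r \<noteq> ?n + 1"
    proof
      assume "r = ?n + 1"
      then have "N = (2 * q + 1) * (?n + 1)" using N by (simp add: algebra_simps)
      with False show False by (metis dvd_triv_right)
    qed
    then show ?thesis using False X by (auto simp: bead_energy_def q_def r_def)
  qed
  moreover have "mirror_count X ?n N = 2 * q + (if ?n < r then 1 else 0) + (if Suc ?n < r then 1 else 0)"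
    using X by (simp add: mirror_count_def residue_count_eq q_def r_def)
  ultimately show ?thesis using X by simp
qed

lemma sum_mset_indicator:
  "(\<Sum>N\<in>#M. if P N then 1 else 0 :: nat) = size {#N \<in># M. P N#}"
  by (induction M) auto

lemma color_residue_image:
  "color_residue X \<Lambda> ` {..rank X} = {..rank X}"
proof -
  have "(\<lambda>i. n - i) ` {..n} = {..n}" for n :: nat
  proof (intro equalityI subsetI)
    fix i assume "i \<in> {..n}"
    then show "i \<in> (\<lambda>i. n - i) ` {..n}" by (intro image_eqI[of _ _ "n - i"]) auto
  qed auto
  then show ?thesis by (cases X) (auto simp: color_residue_def image_def)
qed

definition residue_beads :: "affine_type \<Rightarrow> nat multiset \<Rightarrow> nat \<Rightarrow> nat multiset" where
  "residue_beads X M k = {#N \<in># M. N mod period X = k#}"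

text \<open>The numbers of blocks must be proportional to the marks, which means that all mirror counts
  agree.  By the step lemma this is the equality of the numbers of beads on paired runners, and the
  common value, which is read off in the middle, determines the total energy.\<close>

lemma wt_iff_balanced_and_energy:
  assumes "admissible X" "finite {k. Y k \<noteq> 0}"
  shows "wt X \<Lambda> Y = (\<lambda>h. \<Lambda> h - int m * null_root X h) \<longleftrightarrow>
    (\<forall>k\<in>{1..rank X}. size (residue_beads X (beads Y) k) =
                      size (residue_beads X (beads Y) (period X - k))) \<and>
    (\<Sum>N\<in>#beads Y. bead_energy X N) = m"
proof -
  let ?M = "beads Y" and ?n = "rank X"
  define S where "S p = (\<Sum>N\<in>#beads Y. mirror_count X p N)" for p
  have mark: "mark X i > 0" for i by (cases X) auto
  have eps: "eps X > 0" by (cases X) auto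
  have added: "added_blocks X \<Lambda> Y i = m * mark X i \<longleftrightarrow> eps X * S (color_residue X \<Lambda> i) = 2 * m"
    if "i \<le> ?n" for i
  proof -
    have "2 * added_blocks X \<Lambda> Y i = mark X i * (eps X * S (color_residue X \<Lambda> i))"
      unfolding added_blocks_eq_sum_beads[OF assms(2)] S_def sum_mset_distrib_left
      by (simp add: color_count_eq_mirror_count[OF assms(1) that] mult_ac)
    moreover have "added_blocks X \<Lambda> Y i = m * mark X i \<longleftrightarrow>
        2 * added_blocks X \<Lambda> Y i = mark X i * (2 * m)" by auto
    ultimately show ?thesis using mark[of i] by simp
  qed
  have step: "S (k - 1) + size (residue_beads X ?M (period X - k)) = S k + size (residue_beads X ?M k)"
    if "k \<in> {1..?n}" for k
  proof -
    have "1 \<le> k" "k < period X" using that type_parameters[OF assms(1)] by auto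
    from mirror_count_step[OF this] show ?thesis
      unfolding S_def residue_beads_def sum_mset_indicator[symmetric] sum_mset.distrib[symmetric]
      by simp
  qed
  have energy: "2 * (\<Sum>N\<in>#?M. bead_energy X N) = eps X * S ?n"
    unfolding S_def sum_mset_distrib_left by (simp add: bead_energy_eq_mirror_count[OF assms(1)])
  have "wt X \<Lambda> Y = (\<lambda>h. \<Lambda> h - int m * null_root X h) \<longleftrightarrow>
      (\<forall>p\<in>color_residue X \<Lambda> ` {..?n}. eps X * S p = 2 * m)"
    by (auto simp: wt_eq_iff[OF assms(1)] added)
  also have "\<dots> \<longleftrightarrow> (\<forall>p\<le>?n. eps X * S p = 2 * m)"
    by (auto simp: color_residue_image)
  also have "\<dots> \<longleftrightarrow> (\<forall>k\<in>{1..?n}. S (k - 1) = S k) \<and> eps X * S ?n = 2 * m"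
    (is "?A \<longleftrightarrow> ?B \<and> ?C")
  proof
    assume A: ?A
    have "S (k - 1) = S k" if "k \<in> {1..?n}" for k
    proof -
      have "eps X * S (k - 1) = eps X * S k" using A that by auto
      then show ?thesis using eps by simp
    qed
    with A show "?B \<and> ?C" by auto
  next
    assume BC: "?B \<and> ?C"
    \<comment> \<open>downward induction from the middle level\<close>
    have "S (?n - j) = S ?n" for j
    proof (induction j)
      case (Suc j)
      show ?case
      proof (cases "j < ?n")
        case True
        then have "?n - j \<in> {1..?n}" by auto
        with BC have "S (?n - j - 1) = S (?n - j)" by blast
        with Suc show ?thesis by simp
      qed (use Suc in simp)
    qed simp
    then have const: "S p = S ?n" if "p \<le> ?n" for p by (metis diff_diff_cancel that)
    show ?A
    proof (intro allI impI)
      fix p assume "p \<le> ?n"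
      show "eps X * S p = 2 * m" unfolding const[OF \<open>p \<le> ?n\<close>] using BC by blast
    qed
  qed
  also have "?B \<longleftrightarrow> (\<forall>k\<in>{1..?n}. size (residue_beads X ?M k) = size (residue_beads X ?M (period X - k)))"
  proof (intro ball_cong refl)
    fix k assume "k \<in> {1..?n}"
    from step[OF this] show "S (k - 1) = S k \<longleftrightarrow>
        size (residue_beads X ?M k) = size (residue_beads X ?M (period X - k))"
      by linarith
  qed
  also have "?C \<longleftrightarrow> (\<Sum>N\<in>#?M. bead_energy X N) = m"
    using energy by auto
  finally show ?thesis .
qed

section \<open>Runners\<close>

text \<open>The runners other than $R_\ell$; they come in pairs $R_k$, $R_{L-k}$.\<close>

definition paired_runners :: "affine_type \<Rightarrow> nat set" where
  "paired_runners X = {k. 1 \<le> k \<and> k < period X \<and> k \<noteq> ell X}"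

lemma finite_paired_runners [simp]: "finite (paired_runners X)"
  by (rule finite_subset[of _ "{..<period X}"]) (auto simp: paired_runners_def)

lemma paired_runners_eq:
  assumes "admissible X"
  shows "paired_runners X = {1..rank X} \<union> (\<lambda>k. period X - k) ` {1..rank X}"
proof -
  have "j \<in> (\<lambda>k. period X - k) ` {1..rank X} \<longleftrightarrow> period X - rank X \<le> j \<and> j < period X" for j
  proof
    assume "period X - rank X \<le> j \<and> j < period X"
    then show "j \<in> (\<lambda>k. period X - k) ` {1..rank X}"
      by (intro image_eqI[of _ _ "period X - j"]) auto
  qed (use type_parameters[OF assms] in auto)
  then show ?thesis
    using type_parameters[OF assms] by (auto simp: paired_runners_def)
qed

lemma paired_runnersI:
  assumes "admissible X" "k \<in> {1..rank X}"
  shows "k \<in> paired_runners X" "period X - k \<in> paired_runners X" "rank X < period X - k"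
  using assms type_parameters[OF assms(1)] by (auto simp: paired_runners_eq)

lemma sum_paired_runners:
  fixes g :: "nat \<Rightarrow> nat"
  assumes "admissible X"
  shows "(\<Sum>j\<in>paired_runners X. g j) = (\<Sum>k\<in>{1..rank X}. g k + g (period X - k))"
proof -
  have "{1..rank X} \<inter> (\<lambda>k. period X - k) ` {1..rank X} = {}"
    using paired_runnersI(3)[OF assms] by fastforce
  moreover have "inj_on (\<lambda>k. period X - k) {1..rank X}"
    using type_parameters[OF assms] by (auto simp: inj_on_def)
  ultimately show ?thesis
    by (simp add: paired_runners_eq[OF assms] sum.union_disjoint sum.reindex sum.distrib o_def)
qed

text \<open>Every positive position lies on exactly one runner: as $\ell$ divides $L$, divisibility by $\ell$
  only depends on the residue modulo $L$.\<close>

lemma ell_dvd_iff: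
  assumes "admissible X"
  shows "ell X dvd N \<longleftrightarrow> N mod period X \<notin> paired_runners X"
  using type_parameters(2)[OF assms]
proof (elim disjE conjE)
  assume X: "period X = 2 * rank X + 1" "ell X = period X"
  then have "N mod period X < period X" by simp
  then show ?thesis using X(2) by (auto simp: paired_runners_def dvd_eq_mod_eq_0)
next
  assume X: "period X = 2 * rank X + 2" "ell X = rank X + 1"
  define r where "r = N mod period X"
  have r: "r < 2 * ell X" using X by (simp add: r_def)
  have "ell X dvd period X" using X by (intro dvdI[of _ _ 2]) simp
  then have "ell X dvd N \<longleftrightarrow> ell X dvd r" by (simp add: r_def dvd_mod_iff)
  also have "\<dots> \<longleftrightarrow> r = 0 \<or> r = ell X"
  proof
    assume "ell X dvd r"
    then obtain t where t: "r = ell X * t" by blast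
    with r have "t < 2" by (cases "t < 2") (auto simp: not_less dest: mult_le_mono2[of 2 t "ell X"])
    then have "t = 0 \<or> t = 1" by auto
    with t show "r = 0 \<or> r = ell X" by auto
  qed auto
  also have "\<dots> \<longleftrightarrow> r \<notin> paired_runners X" using r X by (auto simp: paired_runners_def)
  finally show ?thesis by (simp add: r_def)
qed

lemma mset_runner_beads:
  assumes "k \<in> paired_runners X"
  shows "mset (runner_beads X Y k) = residue_beads X (beads Y) k"
  using assms unfolding runner_beads_def residue_beads_def paired_runners_def
  by (auto simp: runner_def intro!: filter_mset_cong gr0I)

lemma mset_runner_beads_ell:
  assumes "0 \<notin># beads Y"
  shows "mset (runner_beads X Y (ell X)) = {#N \<in># beads Y. ell X dvd N#}"
  unfolding runner_beads_def using assms
  by (auto simp: runner_def intro!: filter_mset_cong gr0I)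

lemma runner_beads_eqI:
  assumes "sorted_wrt (\<ge>) xs" "mset (runner_beads X Y k) = mset xs"
  shows "runner_beads X Y k = xs"
proof -
  have "runner_beads X Y k = rev (sorted_list_of_multiset (mset (runner_beads X Y k)))"
    by (simp add: runner_beads_def)
  then show ?thesis using assms by (metis rev_sorted_list_of_multiset_mset)
qed

lemma sorted_runner_beads: "sorted_wrt (\<ge>) (runner_beads X Y k)"
  unfolding runner_beads_def by (rule sorted_rev_sorted_list_of_multiset)

lemma runner_beads_eq_map_mu:
  assumes "k \<in> paired_runners X"
  shows "runner_beads X Y k = map (\<lambda>x. x * period X + k) (mu X Y k)"
proof -
  have "N = (N - k) div period X * period X + k" if "N \<in> set (runner_beads X Y k)" for N
  proof -
    have "N \<in># mset (runner_beads X Y k)" using that by simp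
    then have N: "N mod period X = k"
      unfolding mset_runner_beads[OF assms] by (simp add: residue_beads_def)
    then have "period X dvd N - k" by (metis dvd_minus_mod)
    moreover have "k \<le> N" using N by (metis mod_less_eq_dividend)
    ultimately show ?thesis by simp
  qed
  then show ?thesis unfolding mu_def map_map o_def by (metis (no_types, lifting) map_idI)
qed

lemma residue_beads_eq_image_mu:
  assumes "k \<in> paired_runners X"
  shows "residue_beads X (beads Y) k = image_mset (\<lambda>x. x * period X + k) (mset (mu X Y k))"
  unfolding mset_runner_beads[OF assms, symmetric]
  by (subst runner_beads_eq_map_mu[OF assms]) simp

text \<open>Positions on a paired runner are not multiples of $\ell$, so they carry at most one bead each.\<close>

lemma strictly_decreasing_mu:
  assumes "admissible X" "proper_beads X (beads Y)" "k \<in> paired_runners X"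
  shows "sorted_wrt (>) (mu X Y k)"
proof -
  let ?R = "runner_beads X Y k"
  have "count (mset ?R) N \<le> 1" for N
    using assms ell_dvd_iff[OF assms(1), of N]
    unfolding mset_runner_beads[OF assms(3)] residue_beads_def proper_beads_def by auto
  then have "distinct ?R"
    by (metis distinct_count_atmost_1 count_greater_eq_one_iff count_inI le_antisym set_mset_mset)
  with sorted_runner_beads[of X Y k] have "sorted_wrt (>) ?R"
    by (simp add: sorted_wrt_iff_nth_less nth_eq_iff_index_eq order.strict_iff_order)
  then have "sorted_wrt (\<lambda>x y. y * period X + k < x * period X + k) (mu X Y k)"
    unfolding runner_beads_eq_map_mu[OF assms(3)] by (simp only: sorted_wrt_map)
  then show ?thesis by (rule sorted_wrt_mono_rel[rotated]) simp
qed

lemma size_residue_beads: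
  assumes "k \<in> paired_runners X"
  shows "size (residue_beads X (beads Y) k) = length (mu X Y k)"
  by (simp add: residue_beads_eq_image_mu[OF assms])

text \<open>The partition $\lambda^{(0)}$.\<close>

definition zero_component :: "affine_type \<Rightarrow> wall \<Rightarrow> nat list" where
  "zero_component X Y = map (\<lambda>N. N div ell X) (runner_beads X Y (ell X))"

lemma runner_beads_ell_eq_map:
  assumes "0 \<notin># beads Y"
  shows "runner_beads X Y (ell X) = map (\<lambda>x. x * ell X) (zero_component X Y)"
proof -
  have "ell X dvd N" if "N \<in> set (runner_beads X Y (ell X))" for N
  proof -
    have "N \<in># mset (runner_beads X Y (ell X))" using that by simp
    then show ?thesis unfolding mset_runner_beads_ell[OF assms] by simp
  qed
  then show ?thesis unfolding zero_component_def map_map o_def by (simp add: map_idI)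
qed

lemma ell_beads_eq_image:
  assumes "0 \<notin># beads Y"
  shows "{#N \<in># beads Y. ell X dvd N#} = image_mset (\<lambda>x. x * ell X) (mset (zero_component X Y))"
  unfolding mset_runner_beads_ell[OF assms, symmetric]
  by (subst runner_beads_ell_eq_map[OF assms]) simp

lemma is_partition_zero_component:
  assumes "0 \<notin># beads Y"
  shows "is_partition (zero_component X Y)"
proof -
  have "sorted_wrt (\<ge>) (zero_component X Y)"
    unfolding zero_component_def sorted_wrt_map
    by (rule sorted_wrt_mono_rel[OF _ sorted_runner_beads]) (auto intro: div_le_mono)
  moreover have "0 \<notin> set (zero_component X Y)"
  proof
    assume "0 \<in> set (zero_component X Y)"
    then have "0 * ell X \<in># {#N \<in># beads Y. ell X dvd N#}"
      unfolding ell_beads_eq_image[OF assms] by force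
    with assms show False by simp
  qed
  ultimately show ?thesis by (simp add: is_partition_def)
qed

section \<open>The bijection\<close>

lemma sum_mset_over_runners:
  fixes f :: "nat \<Rightarrow> nat"
  assumes "admissible X"
  shows "(\<Sum>N\<in>#M. f N) = (\<Sum>N\<in>#{#N \<in># M. ell X dvd N#}. f N) +
    (\<Sum>j\<in>paired_runners X. \<Sum>N\<in>#residue_beads X M j. f N)"
proof (induction M)
  case empty
  then show ?case by (simp add: residue_beads_def)
next
  case (add N M)
  have "(\<Sum>j\<in>paired_runners X. \<Sum>N\<in>#residue_beads X (add_mset N M) j. f N) =
      (\<Sum>j\<in>paired_runners X. (if j = N mod period X then f N else 0) + (\<Sum>N\<in>#residue_beads X M j. f N))"
    by (intro sum.cong) (auto simp: residue_beads_def)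
  also have "\<dots> = (if ell X dvd N then 0 else f N) +
      (\<Sum>j\<in>paired_runners X. \<Sum>N\<in>#residue_beads X M j. f N)"
    unfolding sum.distrib ell_dvd_iff[OF assms] by (simp add: sum.delta)
  finally show ?case using add by simp
qed

lemma multiset_eq_over_runners:
  assumes "admissible X" "{#N \<in># M. ell X dvd N#} = {#N \<in># M'. ell X dvd N#}"
    and "\<And>j. j \<in> paired_runners X \<Longrightarrow> residue_beads X M j = residue_beads X M' j"
  shows "M = M'"
proof (rule multiset_eqI)
  fix N
  show "count M N = count M' N"
  proof (cases "ell X dvd N")
    case True
    then show ?thesis using arg_cong[OF assms(2), of "\<lambda>M. count M N"] by simp
  next
    case False
    then have "N mod period X \<in> paired_runners X" by (simp add: ell_dvd_iff[OF assms(1)])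
    from arg_cong[OF assms(3)[OF this], of "\<lambda>M. count M N"] show ?thesis
      by (simp add: residue_beads_def)
  qed
qed

definition balanced :: "affine_type \<Rightarrow> wall \<Rightarrow> bool" where
  "balanced X Y \<longleftrightarrow> (\<forall>k\<in>{1..rank X}.
     size (residue_beads X (beads Y) k) = size (residue_beads X (beads Y) (period X - k)))"

lemma frobenius_coordinates_mu:
  assumes "admissible X" "proper_beads X (beads Y)" "balanced X Y" "k \<in> {1..rank X}"
  shows "frobenius_coordinates (mu X Y k) (mu X Y (period X - k))"
proof -
  note R = paired_runnersI[OF assms(1,4)]
  have "size (residue_beads X (beads Y) k) = size (residue_beads X (beads Y) (period X - k))"
    using assms(3,4) unfolding balanced_def by blast
  then show ?thesis
    using R strictly_decreasing_mu[OF assms(1,2)]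
    by (simp add: frobenius_coordinates_def size_residue_beads)
qed

text \<open>Beads on the second runner of a pair have passed the middle of their period; each of them
  contributes one extra unit.  This unit is the corner box of a hook.\<close>

lemma bead_energy_runner:
  assumes "admissible X" "k \<in> paired_runners X"
  shows "(\<Sum>N\<in>#residue_beads X (beads Y) k. bead_energy X N) =
    eps X * (sum_list (mu X Y k) + (if rank X < k then length (mu X Y k) else 0))"
proof -
  have k: "k < period X" using assms(2) by (simp add: paired_runners_def)
  have e: "bead_energy X (x * period X + k) = eps X * (x + (if rank X < k then 1 else 0))" for x
    using k assms by (simp add: bead_energy_def ell_dvd_iff)
  have "(\<Sum>x\<in>#mset xs. eps X * (x + c)) = eps X * (sum_list xs + c * length xs)" for xs c
    by (induction xs) (simp_all add: algebra_simps)
  then show ?thesis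
    by (simp add: residue_beads_eq_image_mu[OF assms(2)] image_mset.compositionality o_def e)
qed

text \<open>The quantity $m_0 + \epsilon m_1$.\<close>

definition multipartition_size :: "affine_type \<Rightarrow> nat list \<times> nat list list \<Rightarrow> nat" where
  "multipartition_size X = (\<lambda>(p, ps). sum_list p + eps X * (\<Sum>q\<leftarrow>ps. sum_list q))"

lemma pi_map_eq:
  "pi_map X Y = (zero_component X Y,
     map (\<lambda>k. frobenius (mu X Y k) (mu X Y (period X - k))) [1..<rank X + 1])"
  by (simp add: pi_map_def zero_component_def)

text \<open>Energy is additive over the runners.  A pair of runners contributes \<open>eps X\<close> times the sum of
  its arms, its legs and its number of hooks, which is the size of the partition in Frobenius
  notation.\<close>

lemma multipartition_size_pi_map:
  assumes "admissible X" "proper_beads X (beads Y)" "balanced X Y"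
  shows "multipartition_size X (pi_map X Y) = (\<Sum>N\<in>#beads Y. bead_energy X N)"
proof -
  let ?n = "rank X" and ?L = "period X"
  have z: "0 \<notin># beads Y" using assms(2) by (simp add: proper_beads_def)
  have ell: "bead_energy X (x * ell X) = x" for x
    using ell_pos[OF assms(1)] by (simp add: bead_energy_def)
  have zero: "(\<Sum>N\<in>#{#N \<in># beads Y. ell X dvd N#}. bead_energy X N) = sum_list (zero_component X Y)"
    unfolding ell_beads_eq_image[OF z] by (simp add: image_mset.compositionality o_def ell sum_mset_sum_list)
  have "(\<Sum>j\<in>paired_runners X. \<Sum>N\<in>#residue_beads X (beads Y) j. bead_energy X N) =
      eps X * (\<Sum>k\<in>{1..?n}. sum_list (mu X Y k) + sum_list (mu X Y (?L - k)) + length (mu X Y (?L - k)))"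
    unfolding sum_paired_runners[OF assms(1)] sum_distrib_left
  proof (intro sum.cong refl)
    fix k assume k: "k \<in> {1..?n}"
    note R = paired_runnersI[OF assms(1) k]
    show "(\<Sum>N\<in>#residue_beads X (beads Y) k. bead_energy X N) +
        (\<Sum>N\<in>#residue_beads X (beads Y) (?L - k). bead_energy X N) =
        eps X * (sum_list (mu X Y k) + sum_list (mu X Y (?L - k)) + length (mu X Y (?L - k)))"
      unfolding bead_energy_runner[OF assms(1) R(1)] bead_energy_runner[OF assms(1) R(2)]
      using R(3) k by (simp add: algebra_simps)
  qed
  also have "\<dots> = eps X * (\<Sum>k\<in>{1..?n}. sum_list (frobenius (mu X Y k) (mu X Y (?L - k))))"
    using frobenius_coordinates_mu[OF assms]
    by (intro arg_cong[of _ _ "\<lambda>x. eps X * x"] sum.cong refl)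
      (simp add: sum_list_frobenius, simp add: frobenius_coordinates_def)
  finally show ?thesis
    unfolding sum_mset_over_runners[OF assms(1), of _ "beads Y"] zero pi_map_eq multipartition_size_def
    by (simp add: o_def sum_list_distinct_conv_sum_set atLeastLessThanSuc_atLeastAtMost del: upt_Suc)
qed

text \<open>The inverse construction: \<open>g j\<close> lists the quotients of the positions on runner \<open>j\<close>.\<close>

definition assembled_beads :: "affine_type \<Rightarrow> nat list \<Rightarrow> (nat \<Rightarrow> nat list) \<Rightarrow> nat multiset" where
  "assembled_beads X p g = image_mset (\<lambda>x. x * ell X) (mset p) +
     (\<Sum>j\<in>paired_runners X. image_mset (\<lambda>x. x * period X + j) (mset (g j)))"

lemma count_image_mset_affine:
  fixes A :: "nat multiset"
  assumes "j < L"
  shows "count (image_mset (\<lambda>x. x * L + j) A) N = (if N mod L = j then count A (N div L) else 0)"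
proof -
  have "x * L + j = N \<longleftrightarrow> N mod L = j \<and> x = N div L" for x
    using assms by auto
  then show ?thesis
    by (induction A) auto
qed

lemma count_assembled_beads:
  assumes "admissible X"
  shows "count (assembled_beads X p g) N =
    (if ell X dvd N then count (mset p) (N div ell X)
     else count (mset (g (N mod period X))) (N div period X))"
proof -
  have "count (\<Sum>j\<in>paired_runners X. image_mset (\<lambda>x. x * period X + j) (mset (g j))) N =
      (\<Sum>j\<in>paired_runners X. if j = N mod period X then count (mset (g j)) (N div period X) else 0)"
    unfolding count_sum
    by (intro sum.cong) (auto simp: count_image_mset_affine paired_runners_def)
  also have "\<dots> = (if ell X dvd N then 0 else count (mset (g (N mod period X))) (N div period X))"
    by (simp add: sum.delta ell_dvd_iff[OF assms])
  finally show ?thesis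
    using count_image_mset_affine[OF ell_pos[OF assms], of "mset p" N]
    by (simp add: assembled_beads_def dvd_eq_mod_eq_0)
qed

lemma ell_beads_assembled_beads:
  assumes "admissible X"
  shows "{#N \<in># assembled_beads X p g. ell X dvd N#} = image_mset (\<lambda>x. x * ell X) (mset p)"
  by (rule multiset_eqI)
    (use count_image_mset_affine[OF ell_pos[OF assms], of "mset p"] in
      \<open>simp add: count_assembled_beads[OF assms] dvd_eq_mod_eq_0\<close>)

lemma residue_beads_assembled_beads:
  assumes "admissible X" "j \<in> paired_runners X"
  shows "residue_beads X (assembled_beads X p g) j =
    image_mset (\<lambda>x. x * period X + j) (mset (g j))"
proof (rule multiset_eqI)
  fix N
  have "j < period X" using assms(2) by (simp add: paired_runners_def)
  then show "count (residue_beads X (assembled_beads X p g) j) N =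
      count (image_mset (\<lambda>x. x * period X + j) (mset (g j))) N"
    using assms
    by (auto simp: residue_beads_def count_assembled_beads count_image_mset_affine ell_dvd_iff)
qed

lemma proper_beads_assembled_beads:
  assumes "admissible X" "0 \<notin> set p" "\<And>j. j \<in> paired_runners X \<Longrightarrow> distinct (g j)"
  shows "proper_beads X (assembled_beads X p g)"
proof -
  have "count (assembled_beads X p g) 0 = 0"
    using assms(2) by (simp add: count_assembled_beads[OF assms(1)] count_eq_zero_iff)
  moreover have "count (assembled_beads X p g) N \<le> 1" if "\<not> ell X dvd N" for N
    using that assms(3)[of "N mod period X"]
    by (simp add: count_assembled_beads[OF assms(1)] ell_dvd_iff[OF assms(1)] distinct_count_atmost_1)
  ultimately show ?thesis by (simp add: proper_beads_def count_eq_zero_iff)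
qed

definition balanced_walls :: "affine_type \<Rightarrow> weight \<Rightarrow> wall set" where
  "balanced_walls X \<Lambda> = {Y. proper_young_wall X \<Lambda> Y \<and> balanced X Y}"

definition partition_tuples :: "affine_type \<Rightarrow> (nat list \<times> nat list list) set" where
  "partition_tuples X = {(p, ps). is_partition p \<and> length ps = rank X \<and> (\<forall>q\<in>set ps. is_partition q)}"

text \<open>The partitions give back the arms and legs, these give back the beads on each runner, and the
  runners cover all positions.\<close>

lemma inj_on_pi_map:
  assumes "admissible X" "dominant_integral X \<Lambda>" "level X \<Lambda> = 1"
  shows "inj_on (pi_map X) (balanced_walls X \<Lambda>)"
proof (rule inj_onI)
  fix Y Y' assume Y: "Y \<in> balanced_walls X \<Lambda>" and Y': "Y' \<in> balanced_walls X \<Lambda>"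
    and eq: "pi_map X Y = pi_map X Y'"
  have pY: "proper_beads X (beads Y)" "balanced X Y" and pY': "proper_beads X (beads Y')" "balanced X Y'"
    using Y Y' by (auto simp: balanced_walls_def proper_young_wall_iff[OF assms])
  have z: "0 \<notin># beads Y" "0 \<notin># beads Y'" using pY pY' by (auto simp: proper_beads_def)
  have "mu X Y j = mu X Y' j" if "j \<in> paired_runners X" for j
  proof -
    have pair: "mu X Y k = mu X Y' k \<and> mu X Y (period X - k) = mu X Y' (period X - k)"
      if k: "k \<in> {1..rank X}" for k
    proof -
      have "frobenius (mu X Y k) (mu X Y (period X - k)) = frobenius (mu X Y' k) (mu X Y' (period X - k))"
        using eq k by (auto simp: pi_map_eq simp del: upt_Suc)
      with frobenius_bij_betw frobenius_coordinates_mu[OF assms(1) pY k]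
        frobenius_coordinates_mu[OF assms(1) pY' k]
      show ?thesis by (auto simp: bij_betw_def inj_on_def)
    qed
    then show ?thesis using that unfolding paired_runners_eq[OF assms(1)] by blast
  qed
  then have residues: "residue_beads X (beads Y) j = residue_beads X (beads Y') j" if "j \<in> paired_runners X" for j
    using that by (simp add: residue_beads_eq_image_mu)
  have multiples: "{#N \<in># beads Y. ell X dvd N#} = {#N \<in># beads Y'. ell X dvd N#}"
    using eq z by (simp add: ell_beads_eq_image pi_map_eq)
  have "beads Y = beads Y'"
    by (rule multiset_eq_over_runners[OF assms(1) multiples residues])
  then show "Y = Y'"
    by (rule inj_onD[OF bij_betw_imp_inj_on[OF bij_betw_beads[OF assms]]])
      (use Y Y' in \<open>auto simp: balanced_walls_def\<close>)
qed

lemma pi_map_in_partition_tuples: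
  assumes "admissible X" "dominant_integral X \<Lambda>" "level X \<Lambda> = 1" "Y \<in> balanced_walls X \<Lambda>"
  shows "pi_map X Y \<in> partition_tuples X"
proof -
  have Y: "proper_beads X (beads Y)" "balanced X Y"
    using assms(4) by (auto simp: balanced_walls_def proper_young_wall_iff[OF assms(1-3)])
  have "is_partition (frobenius (mu X Y k) (mu X Y (period X - k)))" if "k \<in> {1..rank X}" for k
    using frobenius_bij_betw frobenius_coordinates_mu[OF assms(1) Y that]
    by (auto simp: bij_betw_def)
  moreover have "is_partition (zero_component X Y)"
    using Y by (intro is_partition_zero_component) (simp add: proper_beads_def)
  ultimately show ?thesis
    by (auto simp: partition_tuples_def pi_map_eq simp del: upt_Suc)
qed

text \<open>Arms and legs of the given partitions are placed on paired runners.  Arms and legs of one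
  partition are equally many, so the resulting wall is balanced.\<close>

lemma pi_map_surj:
  assumes "admissible X" "dominant_integral X \<Lambda>" "level X \<Lambda> = 1" "t \<in> partition_tuples X"
  shows "t \<in> pi_map X ` balanced_walls X \<Lambda>"
proof -
  let ?n = "rank X" and ?L = "period X"
  obtain p ps where t: "t = (p, ps)" and p: "is_partition p"
    and ps: "length ps = ?n" "\<And>q. q \<in> set ps \<Longrightarrow> is_partition q"
    using assms(4) by (auto simp: partition_tuples_def)
  have "\<exists>ab. frobenius_coordinates (fst ab) (snd ab) \<and> frobenius (fst ab) (snd ab) = ps ! (k - 1)"
    if "k \<in> {1..?n}" for k
  proof -
    have "is_partition (ps ! (k - 1))" using that ps by auto
    then have "ps ! (k - 1) \<in> (\<lambda>(a, b). frobenius a b) ` {(a, b). frobenius_coordinates a b}"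
      using frobenius_bij_betw by (simp add: bij_betw_def)
    then obtain a b where "frobenius_coordinates a b" "frobenius a b = ps ! (k - 1)" by auto
    then show ?thesis by (intro exI[of _ "(a, b)"]) simp
  qed
  then obtain ab where ab: "\<And>k. k \<in> {1..?n} \<Longrightarrow> frobenius_coordinates (fst (ab k)) (snd (ab k))"
    "\<And>k. k \<in> {1..?n} \<Longrightarrow> frobenius (fst (ab k)) (snd (ab k)) = ps ! (k - 1)"
    by metis
  \<comment> \<open>the legs \<open>fst\<close> go to runner \<open>k\<close>, the arms \<open>snd\<close> to runner \<open>L - k\<close>\<close>
  define g where "g j = (if j \<le> ?n then fst (ab j) else snd (ab (?L - j)))" for j
  have g: "g k = fst (ab k)" "g (?L - k) = snd (ab k)" if "k \<in> {1..?n}" for k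
  proof -
    have "k < ?L" using that type_parameters[OF assms(1)] by auto
    then show "g k = fst (ab k)" "g (?L - k) = snd (ab k)"
      using that paired_runnersI(3)[OF assms(1) that] by (simp_all add: g_def)
  qed
  have sorted: "sorted_wrt (>) (g j)" if "j \<in> paired_runners X" for j
    using that ab(1) g unfolding paired_runners_eq[OF assms(1)] frobenius_coordinates_def by auto
  define M where "M = assembled_beads X p g"
  have M: "proper_beads X M"
    unfolding M_def using p distinct_if_strictly_decreasing[OF sorted]
    by (intro proper_beads_assembled_beads assms(1)) (simp_all add: is_partition_def)
  define Y where "Y = wall_with_beads M"
  have Y: "beads Y = M" and z: "0 \<notin># beads Y"
    using M by (auto simp: Y_def beads_wall_with_beads proper_beads_def)
  have proper: "proper_young_wall X \<Lambda> Y"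
    using M Y by (simp add: proper_young_wall_iff[OF assms(1-3)] Y_def partition_wall_wall_with_beads)
  have mu: "mu X Y j = g j" if j: "j \<in> paired_runners X" for j
  proof -
    have jL: "j < ?L" using j by (simp add: paired_runners_def)
    have "runner_beads X Y j = map (\<lambda>x. x * ?L + j) (g j)"
    proof (rule runner_beads_eqI)
      show "sorted_wrt (\<ge>) (map (\<lambda>x. x * ?L + j) (g j))"
        unfolding sorted_wrt_map by (rule sorted_wrt_mono_rel[OF _ sorted[OF j]]) simp
      show "mset (runner_beads X Y j) = mset (map (\<lambda>x. x * ?L + j) (g j))"
        by (simp add: mset_runner_beads[OF j] Y M_def residue_beads_assembled_beads[OF assms(1) j])
    qed
    with jL show ?thesis by (simp add: mu_def o_def)
  qed
  have "runner_beads X Y (ell X) = map (\<lambda>x. x * ell X) p"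
  proof (rule runner_beads_eqI)
    show "sorted_wrt (\<ge>) (map (\<lambda>x. x * ell X) p)"
      using p unfolding sorted_wrt_map is_partition_def
      by (elim conjE) (rule sorted_wrt_mono_rel[of _ "(\<ge>)"], simp_all)
    show "mset (runner_beads X Y (ell X)) = mset (map (\<lambda>x. x * ell X) p)"
      by (simp add: mset_runner_beads_ell[OF z] Y M_def ell_beads_assembled_beads[OF assms(1)])
  qed
  then have zero: "zero_component X Y = p"
    using ell_pos[OF assms(1)] by (simp add: zero_component_def o_def)
  have "balanced X Y"
    unfolding balanced_def
  proof
    fix k assume k: "k \<in> {1..?n}"
    show "size (residue_beads X (beads Y) k) = size (residue_beads X (beads Y) (?L - k))"
      using ab(1)[OF k] g[OF k] paired_runnersI[OF assms(1) k]
      by (simp add: size_residue_beads mu frobenius_coordinates_def)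
  qed
  with proper have "Y \<in> balanced_walls X \<Lambda>" by (simp add: balanced_walls_def)
  moreover have "map (\<lambda>k. frobenius (mu X Y k) (mu X Y (?L - k))) [1..<?n + 1] = ps"
  proof (rule nth_equalityI)
    fix i assume "i < length (map (\<lambda>k. frobenius (mu X Y k) (mu X Y (?L - k))) [1..<?n + 1])"
    then have i: "i < ?n" by (simp del: upt_Suc)
    then have k: "Suc i \<in> {1..?n}" by simp
    show "map (\<lambda>k. frobenius (mu X Y k) (mu X Y (?L - k))) [1..<?n + 1] ! i = ps ! i"
      using i ab(2)[OF k] g[OF k] paired_runnersI[OF assms(1) k]
      by (simp add: mu del: upt_Suc)
  qed (simp add: ps del: upt_Suc)
  ultimately show ?thesis
    using zero by (intro image_eqI[of _ _ Y]) (simp_all add: t pi_map_eq)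
qed

lemma bij_betw_pi_map:
  assumes "admissible X" "dominant_integral X \<Lambda>" "level X \<Lambda> = 1"
  shows "bij_betw (pi_map X) (balanced_walls X \<Lambda>) (partition_tuples X)"
  unfolding bij_betw_def
  using inj_on_pi_map[OF assms] pi_map_in_partition_tuples[OF assms] pi_map_surj[OF assms] by blast

theorem theorem4p5:
  fixes X :: affine_type and \<Lambda> :: weight and m :: nat
  assumes "admissible X"
    and "dominant_integral X \<Lambda>" and "level X \<Lambda> = 1"
  shows "bij_betw (pi_map X)
    (proper_walls X \<Lambda> (\<lambda>h. \<Lambda> h - int m * null_root X h))
    (\<Union>(m0, m1) \<in> {(m0, m1). m0 + eps X * m1 = m}.
       partitions m0 \<times> multipartitions (rank X) m1)"
proof -
  have size: "multipartition_size X (pi_map X Y) = (\<Sum>N\<in>#beads Y. bead_energy X N)"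
    if "Y \<in> balanced_walls X \<Lambda>" for Y
    using that by (intro multipartition_size_pi_map)
      (auto simp: assms balanced_walls_def proper_young_wall_iff[OF assms])
  have "proper_walls X \<Lambda> (\<lambda>h. \<Lambda> h - int m * null_root X h) =
      {Y. proper_young_wall X \<Lambda> Y \<and> balanced X Y \<and> (\<Sum>N\<in>#beads Y. bead_energy X N) = m}"
    unfolding proper_walls_def
  proof (intro Collect_cong conj_cong refl)
    fix Y assume "proper_young_wall X \<Lambda> Y"
    then have "finite {k. Y k \<noteq> 0}" by (simp add: proper_young_wall_def young_wall_def)
    from wt_iff_balanced_and_energy[OF assms(1) this]
    show "wt X \<Lambda> Y = (\<lambda>h. \<Lambda> h - int m * null_root X h) \<longleftrightarrow>
        balanced X Y \<and> (\<Sum>N\<in>#beads Y. bead_energy X N) = m"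
      unfolding balanced_def .
  qed
  also have "\<dots> = {Y \<in> balanced_walls X \<Lambda>. multipartition_size X (pi_map X Y) = m}"
    using size by (auto simp: balanced_walls_def)
  finally have walls: "proper_walls X \<Lambda> (\<lambda>h. \<Lambda> h - int m * null_root X h) = \<dots>" .
  have tuples: "(\<Union>(m0, m1) \<in> {(m0, m1). m0 + eps X * m1 = m}.
       partitions m0 \<times> multipartitions (rank X) m1) =
      {t \<in> partition_tuples X. multipartition_size X t = m}"
    by (auto simp: partitions_def multipartitions_def partition_tuples_def multipartition_size_def)
  have bij: "bij_betw (pi_map X) (balanced_walls X \<Lambda>) (partition_tuples X)"
    by (rule bij_betw_pi_map[OF assms])
  have "pi_map X ` {Y \<in> balanced_walls X \<Lambda>. multipartition_size X (pi_map X Y) = m} =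
      {t \<in> partition_tuples X. multipartition_size X t = m}"
    unfolding bij_betw_imp_surj_on[OF bij, symmetric] by blast
  then show ?thesis
    unfolding walls tuples by (intro bij_betw_subset[OF bij]) auto
qed

end
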